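(* Assume Schanuel's conjecture holds. Let $f_1,f_2$ be non-zero exponential polynomials over $\overline{\mathbb Q}$ having at least one common zero $\xi\in\mathbb C^*$. Then there exists a non-zero exponential polynomial $f$ over $\overline{\mathbb Q}$ with $f(\xi)=0$ such that $f_1/f$ and $f_2/f$ are exponential polynomials over $\overline{\mathbb Q}$.
   Context: An exponential polynomial over $\overline{\mathbb Q}$ is a function $f(x)=\sum_{i=1}^N P_i(x)e^{\beta_i x}$ with $N\ge1$, $P_i\in\overline{\mathbb Q}[X]$, $\beta_i\in\overline{\mathbb Q}$. Schanuel's conjecture: if $x_1,\dots,x_n\in\mathbb C$ are linearly independent over $\mathbb Q$, then $\overline{\mathbb Q}(x_1,\dots,x_n,e^{x_1},\dots,e^{x_n})$ has transcendence degree at least $n$ over $\overline{\mathbb Q}$. *)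

theory Defs
  imports
    "HOL-Analysis.Analysis"
    "HOL-Computational_Algebra.Polynomial"
    "HOL-Library.Extended_Nat"
    "HOL-Library.Poly_Mapping"
    "HOL-Algebra.Generated_Fields"
    "HOL-Algebra.Algebraic_Closure_Type"
begin

definition algebraic_numbers :: "complex set" where
  "algebraic_numbers = {z. Polynomial.algebraic z}"

text \<open>The subfield \<open>K(S)\<close> of an ambient field given as a type.\<close>

definition field_adjoin :: "'a::field set \<Rightarrow> 'a set \<Rightarrow> 'a set" where
  "field_adjoin K S = generate_field (ring_of_type_algebra :: 'a ring) (K \<union> S)"

text \<open>A value \<open>p\<close> of type \<open>('v \<Rightarrow>\<^sub>0 nat) \<Rightarrow>\<^sub>0 'a\<close> is a multivariate polynomial with variables
  indexed by \<open>'v\<close>: it maps each monomial (a finitely supported exponent vector) to its coefficient.\<close>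

definition mpoly_value :: "(('v \<Rightarrow>\<^sub>0 nat) \<Rightarrow>\<^sub>0 'a::field) \<Rightarrow> ('v \<Rightarrow> 'a) \<Rightarrow> 'a" where
  "mpoly_value p a =
     (\<Sum>m\<in>Poly_Mapping.keys p.
        Poly_Mapping.lookup p m * (\<Prod>v\<in>Poly_Mapping.keys m. a v ^ Poly_Mapping.lookup m v))"

text \<open>The elements of \<open>S\<close> serve as the names of the variables; the variable named \<open>s\<close> is
  evaluated at \<open>s\<close>.\<close>

definition algebraically_independent :: "'a::field set \<Rightarrow> 'a set \<Rightarrow> bool" where
  "algebraically_independent K S \<longleftrightarrow>
     (\<forall>p :: ('a \<Rightarrow>\<^sub>0 nat) \<Rightarrow>\<^sub>0 'a.
        (\<forall>m. Poly_Mapping.lookup p m \<in> K) \<and>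
        (\<forall>m\<in>Poly_Mapping.keys p. Poly_Mapping.keys m \<subseteq> S) \<and>
        mpoly_value p (\<lambda>s. s) = 0 \<longrightarrow> p = 0)"

text \<open>The transcendence degree of \<open>L\<close> over \<open>K\<close>, not distinguishing infinite cardinals.
  Only finite \<open>S\<close> are considered because \<open>card\<close> is \<open>0\<close> on infinite sets.\<close>

definition transcendence_degree :: "'a::field set \<Rightarrow> 'a set \<Rightarrow> enat" where
  "transcendence_degree K L =
     Sup {enat (card S) | S. finite S \<and> S \<subseteq> L \<and> algebraically_independent K S}"

text \<open>Linear independence of the family \<open>x\<^sub>1, \<dots>, x\<^sub>n\<close> over \<open>\<rat>\<close> means that its members are
  distinct and form an independent set.\<close>

definition rat_linearly_independent :: "nat \<Rightarrow> (nat \<Rightarrow> complex) \<Rightarrow> bool" where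
  "rat_linearly_independent n x \<longleftrightarrow>
     inj_on x {1..n} \<and>
     \<not> Modules.module.dependent (\<lambda>(q::rat) (z::complex). of_rat q * z) (x ` {1..n})"

definition schanuel_conjecture :: bool where
  "schanuel_conjecture \<longleftrightarrow>
     (\<forall>(n::nat) (x :: nat \<Rightarrow> complex). rat_linearly_independent n x \<longrightarrow>
        enat n \<le> transcendence_degree algebraic_numbers
                   (field_adjoin algebraic_numbers
                      (x ` {1..n} \<union> (\<lambda>i. exp (x i)) ` {1..n})))"

definition exponential_polynomial :: "(complex \<Rightarrow> complex) \<Rightarrow> bool" where
  "exponential_polynomial f \<longleftrightarrow>
     (\<exists>(N::nat) (P :: nat \<Rightarrow> complex poly) (\<beta> :: nat \<Rightarrow> complex).
        N \<ge> 1 \<and>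
        (\<forall>i\<in>{1..N}. (\<forall>k. Polynomial.coeff (P i) k \<in> algebraic_numbers) \<and>
                     \<beta> i \<in> algebraic_numbers) \<and>
        (\<forall>x. f x = (\<Sum>i=1..N. poly (P i) x * exp (\<beta> i * x))))"

text \<open>\<open>g / f\<close> is an exponential polynomial. Here \<open>g / f\<close> is the quotient in the ring of entire
  functions, so this is stated as \<open>g = f \<cdot> h\<close>; the pointwise HOL quotient would take
  the value \<open>0\<close> at the zeros of \<open>f\<close>. To be used for \<open>f\<close> not identically zero.\<close>

definition quotient_exponential_polynomial ::
    "(complex \<Rightarrow> complex) \<Rightarrow> (complex \<Rightarrow> complex) \<Rightarrow> bool" where
  "quotient_exponential_polynomial g f \<longleftrightarrow>
     (\<exists>h. exponential_polynomial h \<and> (\<forall>x. g x = f x * h x))"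

end

theory Submission
  imports Defs "HOL-Library.Function_Algebras"
begin

text \<open>
  Write the exponents of \<open>f\<^sub>1\<close> and \<open>f\<^sub>2\<close> as integer combinations of algebraic numbers
  \<open>b\<^sub>1, \<dots>, b\<^sub>n\<close> that are linearly independent over \<open>\<rat>\<close>. Up to a unit \<open>exp (\<gamma> x)\<close> both functions
  are polynomials in \<open>g\<^sub>0 = x\<close> and \<open>g\<^sub>i = exp (b\<^sub>i x)\<close>. Schanuel's conjecture for the numbers
  \<open>b\<^sub>i \<xi>\<close> shows that, for some \<open>j\<close>, the \<open>n\<close> numbers \<open>g\<^sub>i(\<xi>)\<close> with \<open>i \<noteq> j\<close> are algebraically
  independent. Hence evaluation at \<open>\<xi>\<close> is injective on the ring \<open>R\<close> generated by these \<open>g\<^sub>i\<close>, its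
  image \<open>A\<close> is factorial, and by Gauss's lemma the polynomials over \<open>A\<close> vanishing at \<open>g\<^sub>j(\<xi>)\<close>
  are the multiples of a single one. Pulled back to functions, this generator is the common factor \<open>f\<close>.
\<close>

hide_const (open) up_ring.coeff up_ring.monom module.smult Polynomials.degree

section \<open>Factorial subrings of a domain\<close>

text \<open>Gauss's lemma enters because the quotients have to be exponential polynomials again:
  division over the fraction field of \<open>R\<close> would leave denominators depending on
  \<open>x\<close>. Factoriality is not studied in the ring of functions, which is no domain, but in
  the image under evaluation at \<open>\<xi>\<close>, which lies in a field; only polynomial
  identities are pulled back. Of the \<open>2n\<close> numbers in Schanuel's conjecture, the
  products \<open>b\<^sub>i \<xi>\<close> depend algebraically on \<open>\<xi>\<close> alone, as the
  \<open>b\<^sub>i\<close> are algebraic. Hence the \<open>n + 1\<close> numbers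
  \<open>g\<^sub>i(\<xi>)\<close> have rank at least \<open>n\<close>, and setting one aside
  suffices. This is what leaves a single variable over a factorial ring; with two values set aside,
  the vanishing ideal could need several generators. The unit \<open>exp (\<gamma> x)\<close> makes
  all exponents non-negative, so that polynomials can replace Laurent polynomials.\<close>

locale ring_set =
  fixes A :: "'a::comm_ring_1 set"
  assumes one_mem: "1 \<in> A"
    and diff_mem: "a \<in> A \<Longrightarrow> b \<in> A \<Longrightarrow> a - b \<in> A"
    and mult_mem: "a \<in> A \<Longrightarrow> b \<in> A \<Longrightarrow> a * b \<in> A"
begin

lemma zero_mem: "0 \<in> A"
  using diff_mem[OF one_mem one_mem] by simp

lemma uminus_mem: "a \<in> A \<Longrightarrow> - a \<in> A"
  using diff_mem[OF zero_mem] by fastforce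

lemma add_mem: "a \<in> A \<Longrightarrow> b \<in> A \<Longrightarrow> a + b \<in> A"
  using diff_mem[OF _ uminus_mem] by fastforce

lemma sum_mem: "(\<And>i. i \<in> I \<Longrightarrow> f i \<in> A) \<Longrightarrow> sum f I \<in> A"
  by (induction I rule: infinite_finite_induct) (auto intro: zero_mem add_mem)

lemma prod_mem: "(\<And>i. i \<in> I \<Longrightarrow> f i \<in> A) \<Longrightarrow> prod f I \<in> A"
  by (induction I rule: infinite_finite_induct) (auto intro: one_mem mult_mem)

lemma power_mem: "a \<in> A \<Longrightarrow> a ^ n \<in> A"
  by (induction n) (auto intro: one_mem mult_mem)

end

section \<open>Polynomials with coefficients in a subring\<close>

definition polys_over :: "'a::zero set \<Rightarrow> 'a poly set" where
  "polys_over A = {P. \<forall>k. coeff P k \<in> A}"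

lemma polys_overI: "(\<And>k. coeff P k \<in> A) \<Longrightarrow> P \<in> polys_over A"
  and polys_overD: "P \<in> polys_over A \<Longrightarrow> coeff P k \<in> A"
  by (auto simp: polys_over_def)

lemma polys_over_mono: "A \<subseteq> B \<Longrightarrow> polys_over A \<subseteq> polys_over B"
  by (auto simp: polys_over_def)

context ring_set
begin

lemma ring_set_polys_over: "ring_set (polys_over A)"
proof
  show "1 \<in> polys_over A"
    by (auto simp: polys_over_def coeff_1 zero_mem one_mem)
  show "P - Q \<in> polys_over A" if "P \<in> polys_over A" "Q \<in> polys_over A" for P Q
    using that by (auto simp: polys_over_def diff_mem)
  show "P * Q \<in> polys_over A" if "P \<in> polys_over A" "Q \<in> polys_over A" for P Q
    using that by (auto simp: polys_over_def coeff_mult intro!: sum_mem mult_mem)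
qed

lemma pCons_mem: "a \<in> A \<Longrightarrow> P \<in> polys_over A \<Longrightarrow> pCons a P \<in> polys_over A"
  by (auto simp: polys_over_def coeff_pCons split: nat.split)

lemma const_poly_mem: "a \<in> A \<Longrightarrow> [:a:] \<in> polys_over A"
  by (auto simp: polys_over_def coeff_pCons zero_mem split: nat.split)

lemma smult_mem: "a \<in> A \<Longrightarrow> P \<in> polys_over A \<Longrightarrow> smult a P \<in> polys_over A"
  by (auto simp: polys_over_def mult_mem)

lemma monom_mem: "a \<in> A \<Longrightarrow> monom a n \<in> polys_over A"
  by (auto simp: polys_over_def zero_mem)

lemma poly_mem: "P \<in> polys_over A \<Longrightarrow> x \<in> A \<Longrightarrow> poly P x \<in> A"
  by (auto simp: poly_altdef polys_over_def intro!: sum_mem mult_mem power_mem)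

end

text \<open>In a field such as the complex numbers the ordinary \<open>dvd\<close> is trivial away
  from zero, so divisibility, units and primes have to refer to the subring
  \<open>A\<close>.\<close>

definition dvd_in :: "'a::comm_ring_1 set \<Rightarrow> 'a \<Rightarrow> 'a \<Rightarrow> bool" where
  "dvd_in A a b \<longleftrightarrow> (\<exists>c\<in>A. b = a * c)"

definition prime_in :: "'a::comm_ring_1 set \<Rightarrow> 'a \<Rightarrow> bool" where
  "prime_in A p \<longleftrightarrow> p \<in> A \<and> p \<noteq> 0 \<and> \<not> dvd_in A p 1 \<and>
     (\<forall>a\<in>A. \<forall>b\<in>A. dvd_in A p (a * b) \<longrightarrow> dvd_in A p a \<or> dvd_in A p b)"

text \<open>Factorisation into primes, rather than irreducibles, forces uniqueness in a domain, so
  its existence is all of factoriality. The count \<open>n\<close> of prime factors later serves as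
  an induction measure.\<close>

inductive prime_product_in :: "'a::comm_ring_1 set \<Rightarrow> nat \<Rightarrow> 'a \<Rightarrow> bool" for A where
  unit: "u \<in> A \<Longrightarrow> dvd_in A u 1 \<Longrightarrow> prime_product_in A 0 u"
| prime_times: "prime_in A p \<Longrightarrow> prime_product_in A n a \<Longrightarrow> prime_product_in A (Suc n) (p * a)"

definition factorial_in :: "'a::comm_ring_1 set \<Rightarrow> bool" where
  "factorial_in A \<longleftrightarrow> (\<forall>a\<in>A. a \<noteq> 0 \<longrightarrow> (\<exists>n. prime_product_in A n a))"

lemma dvd_inI: "c \<in> A \<Longrightarrow> b = a * c \<Longrightarrow> dvd_in A a b"
  by (auto simp: dvd_in_def)

locale domain_set = ring_set A for A :: "'a::idom set"
begin

lemma domain_set_polys_over: "domain_set (polys_over A)"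
  using ring_set_polys_over by (rule domain_set.intro)

lemma dvd_in_trans: "dvd_in A a b \<Longrightarrow> dvd_in A b c \<Longrightarrow> dvd_in A a c"
  unfolding dvd_in_def by (metis mult.assoc mult_mem)

lemma dvd_in_mult: "dvd_in A a b \<Longrightarrow> c \<in> A \<Longrightarrow> dvd_in A a (b * c)"
  unfolding dvd_in_def by (metis mult.assoc mult_mem)

lemma dvd_in_add: "dvd_in A a b \<Longrightarrow> dvd_in A a c \<Longrightarrow> dvd_in A a (b + c)"
  unfolding dvd_in_def by (metis distrib_left add_mem)

lemma dvd_in_diff: "dvd_in A a b \<Longrightarrow> dvd_in A a c \<Longrightarrow> dvd_in A a (b - c)"
  unfolding dvd_in_def by (metis right_diff_distrib diff_mem)

lemma dvd_in_sum: "(\<And>i. i \<in> I \<Longrightarrow> dvd_in A a (f i)) \<Longrightarrow> dvd_in A a (sum f I)"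
  by (induction I rule: infinite_finite_induct) (auto intro: dvd_in_add dvd_inI[OF zero_mem])

lemma unit_mult: "dvd_in A a 1 \<Longrightarrow> dvd_in A b 1 \<Longrightarrow> dvd_in A (a * b) 1"
  unfolding dvd_in_def
  by (metis mult.assoc mult.left_commute mult_1_right mult_mem)

lemma prime_product_in_mem: "prime_product_in A n a \<Longrightarrow> a \<in> A"
  by (induction rule: prime_product_in.induct) (auto simp: prime_in_def mult_mem)

lemma prime_product_in_unit_mult:
  "prime_product_in A n a \<Longrightarrow> u \<in> A \<Longrightarrow> dvd_in A u 1 \<Longrightarrow> prime_product_in A n (u * a)"
proof (induction rule: prime_product_in.induct)
  case (unit v)
  then show ?case by (auto intro: prime_product_in.unit mult_mem unit_mult)
next
  case (prime_times p n a)
  then show ?case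
    using prime_product_in.prime_times[of A p n "u * a"] by (simp add: mult.left_commute)
qed

lemma prime_product_in_mult:
  "prime_product_in A n a \<Longrightarrow> prime_product_in A m b \<Longrightarrow> prime_product_in A (n + m) (a * b)"
  by (induction rule: prime_product_in.induct)
     (auto intro: prime_product_in_unit_mult prime_product_in.intros simp: mult.assoc)

text \<open>The prime \<open>q\<close> divides \<open>p\<close> or \<open>a\<close>. In the first
  case \<open>p = q * u\<close> with a unit \<open>u\<close>, which is absorbed into
  \<open>a\<close>; in the second the induction hypothesis applies to \<open>a\<close> and
  \<open>p\<close> is put back.\<close>

lemma prime_product_in_cancel:
  assumes "prime_product_in A n a" "prime_in A q" "b \<in> A" "a = q * b"
  shows "n > 0 \<and> prime_product_in A (n - 1) b"
  using assms
proof (induction arbitrary: b rule: prime_product_in.induct)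
  case (unit u)
  then have "dvd_in A q 1"
    by (metis dvd_in_def dvd_in_trans)
  then show ?case
    using unit by (simp add: prime_in_def)
next
  case (prime_times p n a)
  have p: "p \<in> A" "p \<noteq> 0" "q \<in> A" "q \<noteq> 0"
    using prime_times.prems prime_times.hyps by (auto simp: prime_in_def)
  have a: "a \<in> A"
    using prime_times.hyps prime_product_in_mem by blast
  have "dvd_in A q (p * a)"
    using prime_times.prems by (auto simp: dvd_in_def)
  then consider "dvd_in A q p" | "dvd_in A q a"
    using prime_times.prems p a unfolding prime_in_def by blast
  then show ?case
  proof cases
    case 1
    then obtain u where u: "u \<in> A" "p = q * u" by (auto simp: dvd_in_def)
    have "dvd_in A p q \<or> dvd_in A p u"
    proof -
      have "dvd_in A p (q * u)"
        by (rule dvd_inI[OF one_mem]) (simp add: u)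
      then show ?thesis
        using prime_times.hyps p u unfolding prime_in_def by blast
    qed
    \<comment> \<open>Otherwise \<open>u = p * w\<close> and \<open>p = q * u\<close> would give
      \<open>1 = q * w\<close>, making \<open>q\<close> a unit.\<close>
    moreover have "\<not> dvd_in A p u"
    proof
      assume "dvd_in A p u"
      then obtain w where w: "w \<in> A" "u = p * w" by (auto simp: dvd_in_def)
      then have "u * 1 = u * (q * w)"
        using u by (metis mult.commute mult.left_commute mult_1_right)
      then have "1 = q * w" using u p by auto
      then show False
        using prime_times.prems w by (auto simp: prime_in_def dvd_in_def)
    qed
    ultimately obtain w where w: "w \<in> A" "q = p * w" by (auto simp: dvd_in_def)
    then have "p * 1 = p * (u * w)"
      using u by (metis mult.commute mult.left_commute mult_1_right)
    then have "dvd_in A u 1" using p w by (auto simp: dvd_in_def)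
    moreover have "b = u * a"
      using u prime_times.prems p by (simp add: mult.assoc)
    ultimately show ?thesis
      using prime_times.hyps u prime_product_in_unit_mult by simp
  next
    case 2
    then obtain c where c: "c \<in> A" "a = q * c" by (auto simp: dvd_in_def)
    then have "n > 0" "prime_product_in A (n - 1) c"
      using prime_times.IH[of c] prime_times.prems by auto
    moreover have "b = p * c"
      using prime_times.prems c p by (simp add: mult.left_commute)
    ultimately show ?thesis
      using prime_product_in.prime_times[OF prime_times.hyps(1)] by fastforce
  qed
qed

section \<open>Constants and constant primes in the polynomial ring\<close>

lemma dvd_in_const_poly_iff:
  assumes "a \<in> A"
  shows "dvd_in (polys_over A) [:a:] P \<longleftrightarrow> (\<forall>k. dvd_in A a (coeff P k))"
proof
  assume "dvd_in (polys_over A) [:a:] P"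
  then show "\<forall>k. dvd_in A a (coeff P k)"
    by (auto simp: dvd_in_def polys_over_def)
next
  assume *: "\<forall>k. dvd_in A a (coeff P k)"
  show "dvd_in (polys_over A) [:a:] P"
    using *
  proof (induction P)
    case 0
    show ?case by (rule dvd_inI[of 0]) (auto simp: polys_over_def zero_mem)
  next
    case (pCons b P)
    have "dvd_in A a b" "\<forall>k. dvd_in A a (coeff P k)"
      using spec[OF pCons.prems, of 0] pCons.prems by (auto simp: coeff_pCons split: nat.splits)
    then obtain c Q where "c \<in> A" "b = a * c" "Q \<in> polys_over A" "P = [:a:] * Q"
      using pCons.IH by (auto simp: dvd_in_def)
    then show ?case
      by (intro dvd_inI[of "pCons c Q"]) (auto intro: pCons_mem)
  qed
qed

text \<open>Gauss's argument: let \<open>i\<close> and \<open>j\<close> be the least indices at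
  which \<open>p\<close> fails to divide the coefficients of \<open>P\<close> and \<open>Q\<close>.
  In the coefficient of \<open>P * Q\<close> at \<open>i + j\<close>, every term except
  \<open>coeff P i * coeff Q j\<close> has a factor divisible by \<open>p\<close>.\<close>

lemma prime_in_const_poly:
  assumes "prime_in A p"
  shows "prime_in (polys_over A) [:p:]"
proof -
  have p: "p \<in> A" "p \<noteq> 0" "\<not> dvd_in A p 1"
    using assms by (auto simp: prime_in_def)
  have "dvd_in (polys_over A) [:p:] P \<or> dvd_in (polys_over A) [:p:] Q"
    if P: "P \<in> polys_over A" and Q: "Q \<in> polys_over A"
      and PQ: "dvd_in (polys_over A) [:p:] (P * Q)" for P Q
  proof (rule ccontr)
    assume "\<not> ?thesis"
    then have ex: "\<exists>i. \<not> dvd_in A p (coeff P i)" "\<exists>j. \<not> dvd_in A p (coeff Q j)"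
      using dvd_in_const_poly_iff p by auto
    define i where "i = (LEAST i. \<not> dvd_in A p (coeff P i))"
    define j where "j = (LEAST j. \<not> dvd_in A p (coeff Q j))"
    have i: "\<not> dvd_in A p (coeff P i)" "\<And>k. k < i \<Longrightarrow> dvd_in A p (coeff P k)"
      using LeastI_ex[OF ex(1)] not_less_Least unfolding i_def by auto
    have j: "\<not> dvd_in A p (coeff Q j)" "\<And>k. k < j \<Longrightarrow> dvd_in A p (coeff Q k)"
      using LeastI_ex[OF ex(2)] not_less_Least unfolding j_def by auto
    have "dvd_in A p (coeff (P * Q) (i + j))"
      using PQ dvd_in_const_poly_iff p by auto
    moreover have "dvd_in A p (\<Sum>k\<in>{..i+j}-{i}. coeff P k * coeff Q (i + j - k))"
    proof (rule dvd_in_sum)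
      fix k assume k: "k \<in> {..i+j}-{i}"
      show "dvd_in A p (coeff P k * coeff Q (i + j - k))"
      proof (cases "k < i")
        case True
        then show ?thesis using i(2) dvd_in_mult polys_overD[OF Q] by blast
      next
        case False
        then have "i + j - k < j" using k by auto
        then show ?thesis
          using j(2) dvd_in_mult polys_overD[OF P] by (metis mult.commute)
      qed
    qed
    ultimately have "dvd_in A p (coeff (P * Q) (i + j) -
        (\<Sum>k\<in>{..i+j}-{i}. coeff P k * coeff Q (i + j - k)))"
      by (rule dvd_in_diff)
    also have "coeff (P * Q) (i + j) = coeff P i * coeff Q j +
        (\<Sum>k\<in>{..i+j}-{i}. coeff P k * coeff Q (i + j - k))"
      by (simp add: coeff_mult sum.remove[of "{..i+j}" i])
    finally have "dvd_in A p (coeff P i * coeff Q j)" by simp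
    then show False
      using assms i(1) j(1) polys_overD[OF P] polys_overD[OF Q] unfolding prime_in_def by blast
  qed
  moreover have "\<not> dvd_in (polys_over A) [:p:] 1"
    using spec[of _ 0] dvd_in_const_poly_iff[OF p(1), of 1] p(3) by (auto simp: coeff_1)
  ultimately show ?thesis
    using p by (auto simp: prime_in_def const_poly_mem)
qed

lemma unit_const_poly:
  assumes "a \<in> A" "dvd_in A a 1"
  shows "dvd_in (polys_over A) [:a:] 1"
proof -
  obtain b where "b \<in> A" "1 = a * b" using assms by (auto simp: dvd_in_def)
  then show ?thesis
    by (intro dvd_inI[of "[:b:]"]) (auto simp: const_poly_mem one_pCons mult.commute)
qed

lemma prime_product_in_const_poly:
  "prime_product_in A n a \<Longrightarrow> prime_product_in (polys_over A) n [:a:]"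
proof (induction rule: prime_product_in.induct)
  case (unit u)
  then show ?case by (intro prime_product_in.unit const_poly_mem unit_const_poly)
next
  case (prime_times p n a)
  have "[:p * a:] = [:p:] * [:a:]" by simp
  then show ?case
    using prime_times prime_in_const_poly prime_product_in.prime_times by metis
qed

text \<open>Testing with primes avoids choosing a content, that is, a gcd of the coefficients. Over
  a field there are no primes and every polynomial counts as primitive.\<close>

definition primitive :: "'a poly \<Rightarrow> bool" where
  "primitive P \<longleftrightarrow> (\<forall>p. prime_in A p \<longrightarrow> \<not> dvd_in (polys_over A) [:p:] P)"

text \<open>The leading coefficient of \<open>G\<close> need not be invertible in \<open>A\<close>,
  so each step of the long division first multiplies by it; \<open>c\<close> ends up as a power of
  it.\<close>

lemma pseudo_division:
  assumes "G \<in> polys_over A" "G \<noteq> 0" "F \<in> polys_over A"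
  shows "\<exists>c\<in>A. \<exists>q\<in>polys_over A. \<exists>r\<in>polys_over A.
           c \<noteq> 0 \<and> smult c F = G * q + r \<and> (r = 0 \<or> degree r < degree G)"
  using assms(3)
proof (induction "degree F" arbitrary: F rule: less_induct)
  case less
  interpret pol: ring_set "polys_over A" by (rule ring_set_polys_over)
  let ?n = "degree F" and ?m = "degree G"
  let ?g = "coeff G ?m" and ?f = "coeff F ?n"
  have g: "?g \<in> A" "?g \<noteq> 0" "?f \<in> A"
    using assms polys_overD less.prems by auto
  show ?case
  proof (cases "F = 0 \<or> ?n < ?m")
    case True
    then show ?thesis
      by (intro bexI[of _ 1] bexI[of _ 0] bexI[of _ F])
         (use less.prems in \<open>auto simp: one_mem pol.zero_mem\<close>)
  next
    case False
    define F' where "F' = smult ?g F - monom ?f (?n - ?m) * G"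
    have F': "F' \<in> polys_over A"
      unfolding F'_def using less.prems assms g
      by (intro pol.diff_mem pol.mult_mem smult_mem monom_mem)
    have step: "smult ?g F = G * monom ?f (?n - ?m) + F'"
      by (simp add: F'_def mult.commute)
    have "coeff F' k = 0" if "k \<ge> ?n" for k
      using that False
      by (cases "k = ?n") (auto simp: F'_def coeff_monom_mult coeff_eq_0)
    then have lt: "F' = 0 \<or> degree F' < ?n"
      by (metis leading_coeff_0_iff linorder_not_le)
    show ?thesis
    proof (cases "F' = 0")
      case True
      then show ?thesis
        using step g
        by (intro bexI[of _ ?g] bexI[of _ "monom ?f (?n - ?m)"] bexI[of _ 0])
           (auto simp: monom_mem pol.zero_mem)
    next
      case nz: False
      then obtain c q r where *: "c \<in> A" "q \<in> polys_over A" "r \<in> polys_over A" "c \<noteq> 0"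
        "smult c F' = G * q + r" "r = 0 \<or> degree r < ?m"
        using less.hyps[of F'] lt F' by blast
      have "smult (c * ?g) F = smult c (smult ?g F)" by simp
      also have "\<dots> = G * (smult c (monom ?f (?n - ?m)) + q) + r"
        unfolding step smult_add_right using *(5) by (simp add: algebra_simps)
      finally show ?thesis
        using * g
        by (intro bexI[of _ "c * ?g"] bexI[of _ "smult c (monom ?f (?n - ?m)) + q"] bexI[of _ r])
           (auto intro!: mult_mem pol.add_mem smult_mem monom_mem)
    qed
  qed
qed

end

section \<open>Primitive polynomials and Gauss's theorem over a factorial subring\<close>

locale factorial_set = domain_set +
  assumes factorial_in: "factorial_in A"
begin

lemma prime_product_exists: "a \<in> A \<Longrightarrow> a \<noteq> 0 \<Longrightarrow> \<exists>n. prime_product_in A n a"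
  using factorial_in by (auto simp: factorial_in_def)

text \<open>Prime factors of \<open>c\<close> are cancelled one at a time: each divides \<open>G * Q\<close>, but not \<open>G\<close>.\<close>

lemma primitive_dvd_cancel:
  assumes "G \<in> polys_over A" "primitive G" "c \<in> A" "c \<noteq> 0"
    and "F \<in> polys_over A" "Q \<in> polys_over A" "smult c F = G * Q"
  shows "dvd_in (polys_over A) G F"
proof -
  obtain n where "prime_product_in A n c"
    using assms prime_product_exists by blast
  then show ?thesis
    using assms(5-)
  proof (induction arbitrary: Q rule: prime_product_in.induct)
    case (unit u)
    then obtain v where v: "v \<in> A" "1 = u * v" by (auto simp: dvd_in_def)
    have "F = smult v (smult u F)"
      using v by (simp add: mult.commute)
    then have "F = G * smult v Q" using unit by simp
    then show ?case
      using smult_mem[OF v(1)] unit dvd_inI by blast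
  next
    case (prime_times p n a)
    have p: "p \<in> A" "p \<noteq> 0"
      using prime_times.hyps by (auto simp: prime_in_def)
    have a: "a \<in> A"
      using prime_times.hyps prime_product_in_mem by blast
    have "dvd_in (polys_over A) [:p:] (G * Q)"
      by (rule dvd_inI[of "smult a F"])
         (use prime_times.prems a in \<open>auto simp: smult_mem mult.commute\<close>)
    then have "dvd_in (polys_over A) [:p:] Q"
      using prime_in_const_poly[OF prime_times.hyps(1)] prime_times assms
      unfolding prime_in_def primitive_def by blast
    then obtain Q' where Q': "Q' \<in> polys_over A" "Q = smult p Q'" by (auto simp: dvd_in_def)
    have "smult p (smult a F) = smult p (G * Q')"
      using prime_times.prems Q' by simp
    then have "smult a F = G * Q'"
      using p(2) smult_cancel by blast
    then show ?case using prime_times Q' by blast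
  qed
qed

text \<open>Each prime split off \<open>G\<close> is also split off its leading coefficient; the
  induction runs on the number of prime factors of that coefficient.\<close>

lemma primitive_part_exists:
  assumes "G \<in> polys_over A" "G \<noteq> 0"
  shows "\<exists>c\<in>A. \<exists>G'\<in>polys_over A. c \<noteq> 0 \<and> G = smult c G' \<and> primitive G'"
proof -
  obtain n where "prime_product_in A n (coeff G (degree G))"
    using assms prime_product_exists polys_overD leading_coeff_0_iff by metis
  then show ?thesis
    using assms
  proof (induction n arbitrary: G rule: less_induct)
    case (less n)
    show ?case
    proof (cases "primitive G")
      case True
      then show ?thesis
        using less.prems by (intro bexI[of _ 1] bexI[of _ G]) (auto simp: one_mem)
    next
      case False
      then obtain p H where p: "prime_in A p" and H: "H \<in> polys_over A" "G = smult p H"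
        by (auto simp: primitive_def dvd_in_def)
      then have pnz: "p \<noteq> 0" "p \<in> A" by (auto simp: prime_in_def)
      have "coeff G (degree G) = p * coeff H (degree H)"
        using H pnz by simp
      then have "n > 0" "prime_product_in A (n - 1) (coeff H (degree H))"
        using prime_product_in_cancel[OF less.prems(1) p] polys_overD[OF H(1)] by auto
      then obtain c G' where "c \<in> A" "G' \<in> polys_over A" "c \<noteq> 0" "H = smult c G'" "primitive G'"
        using less.IH[of "n - 1" H] H less.prems by auto
      then show ?thesis
        using H pnz by (intro bexI[of _ "p * c"] bexI[of _ G']) (auto simp: mult_mem)
    qed
  qed
qed

lemma primitive_const_unit:
  assumes "a \<in> A" "a \<noteq> 0" "primitive (smult a G)" "G \<in> polys_over A"
  shows "dvd_in A a 1"
proof -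
  obtain n where n: "prime_product_in A n a"
    using assms prime_product_exists by blast
  then show ?thesis
  proof cases
    case (prime_times p n b)
    have "dvd_in (polys_over A) [:p:] (smult a G)"
      by (rule dvd_inI[of "smult b G"])
         (use prime_times assms prime_product_in_mem in \<open>auto intro!: smult_mem simp: mult.commute\<close>)
    then show ?thesis using assms prime_times by (auto simp: primitive_def)
  qed auto
qed

text \<open>\<open>J\<close> stands for the trace on \<open>A[X]\<close> of an ideal over the
  fraction field, which is the reason for saturation. An element of least degree generates over the
  field; its primitive part stays in \<open>J\<close> by saturation and divides all of
  \<open>J\<close> without denominators. The shape \<open>smult c P - Q * R\<close> is that of a
  remainder in pseudo-division.\<close>

lemma minimal_degree_generator:
  assumes J: "J \<subseteq> polys_over A"
    and closed: "\<And>P Q c R. P \<in> J \<Longrightarrow> Q \<in> J \<Longrightarrow> c \<in> A \<Longrightarrow> R \<in> polys_over A \<Longrightarrow> smult c P - Q * R \<in> J"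
    and saturated: "\<And>c P. c \<in> A \<Longrightarrow> c \<noteq> 0 \<Longrightarrow> P \<in> polys_over A \<Longrightarrow> smult c P \<in> J \<Longrightarrow> P \<in> J"
    and nonzero: "P0 \<in> J" "P0 \<noteq> 0"
  shows "\<exists>H\<in>J. H \<noteq> 0 \<and> primitive H \<and> (\<forall>F\<in>J. dvd_in (polys_over A) H F)"
proof -
  obtain H0 where H0: "H0 \<in> J" "H0 \<noteq> 0"
    "\<And>F. F \<in> J \<Longrightarrow> F \<noteq> 0 \<Longrightarrow> degree H0 \<le> degree F"
    using ex_has_least_nat[of "\<lambda>P. P \<in> J \<and> P \<noteq> 0" P0 degree] nonzero by blast
  then obtain c H where c: "c \<in> A" "H \<in> polys_over A" "c \<noteq> 0" "H0 = smult c H" "primitive H"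
    using primitive_part_exists[OF subsetD[OF J H0(1)] H0(2)] by blast
  have H: "H \<in> J" "H \<noteq> 0"
    using c H0 saturated[of c H] by auto
  have "dvd_in (polys_over A) H F" if F: "F \<in> J" for F
  proof -
    obtain d q r where dqr: "d \<in> A" "q \<in> polys_over A" "r \<in> polys_over A" "d \<noteq> 0"
      "smult d F = H * q + r" "r = 0 \<or> degree r < degree H"
      using pseudo_division[OF c(2) H(2) subsetD[OF J F]] by blast
    have "r = smult d F - H * q" using dqr by simp
    then have "r \<in> J" using closed[OF F H(1) dqr(1,2)] by simp
    moreover have "degree H0 = degree H" using c by simp
    ultimately have "r = 0" using H0(3)[of r] dqr(6) by (cases "r = 0") auto
    then show ?thesis
      using primitive_dvd_cancel[OF c(2,5) dqr(1,4) subsetD[OF J F] dqr(2)] dqr(5) by auto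
  qed
  then show ?thesis using H c by blast
qed

text \<open>A Bezout argument over the fraction field with denominators cleared. The generator
  \<open>H\<close> of the ideal of \<open>G\<close> and \<open>U\<close> divides \<open>G\<close>,
  so \<open>H\<close> or its cofactor is constant. A constant cofactor makes \<open>G\<close> divide
  \<open>U\<close>, a constant \<open>H\<close> makes it divide \<open>V\<close>.\<close>

lemma indecomposable_prime:
  assumes G: "G \<in> polys_over A" "primitive G" "degree G > 0"
    and indec: "\<And>H K. H \<in> polys_over A \<Longrightarrow> K \<in> polys_over A \<Longrightarrow> G = H * K \<Longrightarrow>
                  degree H = 0 \<or> degree K = 0"
  shows "prime_in (polys_over A) G"
proof -
  interpret pol: domain_set "polys_over A" by (rule domain_set_polys_over)
  have G0: "G \<noteq> 0" using G by auto
  have main: "dvd_in (polys_over A) G U \<or> dvd_in (polys_over A) G V"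
    if U: "U \<in> polys_over A" and V: "V \<in> polys_over A"
      and UV: "dvd_in (polys_over A) G (U * V)" for U V
  proof -
    \<comment> \<open>Combinations of \<open>G\<close> and \<open>U\<close> over the fraction field,
      with \<open>c\<close> as common denominator.\<close>
    define J where "J = {P\<in>polys_over A. \<exists>c\<in>A. \<exists>a\<in>polys_over A. \<exists>b\<in>polys_over A.
      c \<noteq> 0 \<and> smult c P = a * G + b * U}"
    have J: "G \<in> J" "U \<in> J"
    proof -
      have "smult 1 G = 1 * G + 0 * U" "smult 1 U = 0 * G + 1 * U" by auto
      moreover have "(1::'a) \<noteq> 0" by simp
      ultimately show "G \<in> J" "U \<in> J"
        unfolding J_def mem_Collect_eq using G U one_mem pol.one_mem pol.zero_mem by blast+
    qed
    have closed: "smult c P - Q * R \<in> J"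
      if PQ: "P \<in> J" "Q \<in> J" and "c \<in> A" "R \<in> polys_over A" for P Q c R
    proof -
      obtain d a b where P: "P \<in> polys_over A" "d \<in> A" "a \<in> polys_over A" "b \<in> polys_over A" "d \<noteq> 0"
        "smult d P = a * G + b * U" using PQ(1) unfolding J_def by blast
      obtain d' a' b' where Q: "Q \<in> polys_over A" "d' \<in> A" "a' \<in> polys_over A" "b' \<in> polys_over A" "d' \<noteq> 0"
        "smult d' Q = a' * G + b' * U" using PQ(2) unfolding J_def by blast
      have "smult (d * d') (smult c P - Q * R)
          = smult (d' * c) (smult d P) - smult d (smult d' Q * R)"
        by (simp add: smult_diff_right mult_ac)
      also have "\<dots> = (smult (d' * c) a - smult d (a' * R)) * G + (smult (d' * c) b - smult d (b' * R)) * U"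
        unfolding P(6) Q(6) by (simp add: algebra_simps smult_add_right smult_diff_right)
      finally have eq: "smult (d * d') (smult c P - Q * R) =
          (smult (d' * c) a - smult d (a' * R)) * G + (smult (d' * c) b - smult d (b' * R)) * U" .
      have mem: "d * d' \<in> A" "smult c P - Q * R \<in> polys_over A"
        "smult (d' * c) a - smult d (a' * R) \<in> polys_over A"
        "smult (d' * c) b - smult d (b' * R) \<in> polys_over A"
        using P Q that by (auto intro!: mult_mem pol.diff_mem pol.mult_mem smult_mem)
      have "d * d' \<noteq> 0" using P Q by simp
      then show ?thesis
        unfolding J_def using mem eq by blast
    qed
    have saturated: "P \<in> J" if "c \<in> A" "c \<noteq> 0" "P \<in> polys_over A" and cP: "smult c P \<in> J" for c P
    proof -
      obtain d a b where "d \<in> A" "a \<in> polys_over A" "b \<in> polys_over A" "d \<noteq> 0"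
        "smult d (smult c P) = a * G + b * U" using cP unfolding J_def by blast
      moreover have "d * c \<in> A" "d * c \<noteq> 0" using that calculation mult_mem by auto
      ultimately show ?thesis unfolding J_def mem_Collect_eq smult_smult using that by blast
    qed
    have "\<exists>H\<in>J. H \<noteq> 0 \<and> primitive H \<and> (\<forall>F\<in>J. dvd_in (polys_over A) H F)"
    proof (rule minimal_degree_generator[OF _ _ _ J(1) G0])
      show "J \<subseteq> polys_over A" unfolding J_def by (rule Collect_restrict)
    qed (fact closed, fact saturated)
    then obtain H where H: "H \<in> J" "\<forall>F\<in>J. dvd_in (polys_over A) H F" by blast
    then have H: "H \<in> J" "dvd_in (polys_over A) H G" "dvd_in (polys_over A) H U"
      using J by blast+
    then obtain K where K: "K \<in> polys_over A" "G = H * K" unfolding dvd_in_def by blast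
    have "H \<in> polys_over A" using H by (simp add: J_def)
    from indec[OF this K] show ?thesis
    proof
      assume "degree K = 0"
      then obtain k where k: "K = [:k:]" by (rule degree_eq_zeroE)
      have "k \<in> A" using K k polys_overD[of K A 0] by simp
      moreover have "k \<noteq> 0" using K k G0 by auto
      \<comment> \<open>\<open>G\<close> is primitive and equals \<open>smult k H\<close>, so the
        constant \<open>k\<close> has no prime factor.\<close>
      ultimately have "dvd_in A k 1"
        using primitive_const_unit[of k H] K k G \<open>H \<in> polys_over A\<close> by (simp add: mult.commute)
      then obtain v where v: "v \<in> A" "1 = k * v" by (auto simp: dvd_in_def)
      have "H = G * [:v:]" using K k v by (simp add: mult.commute[of v])
      then have "dvd_in (polys_over A) G H" by (rule dvd_inI[OF const_poly_mem[OF v(1)]])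
      then show ?thesis using pol.dvd_in_trans[OF _ H(3)] by blast
    next
      assume "degree H = 0"
      then obtain h where h: "H = [:h:]" by (rule degree_eq_zeroE)
      have hA: "h \<in> A" "h \<noteq> 0" using \<open>H \<in> polys_over A\<close> h polys_overD[of H A 0] K G0 by auto
      obtain c a b where c: "c \<in> A" "a \<in> polys_over A" "b \<in> polys_over A" "c \<noteq> 0"
        "smult c H = a * G + b * U" using H by (auto simp: J_def)
      obtain W where W: "W \<in> polys_over A" "U * V = G * W" using UV by (auto simp: dvd_in_def)
      \<comment> \<open>Multiplying the Bezout relation by \<open>V\<close> makes both terms
        multiples of \<open>G\<close>; the constant \<open>c * h\<close> can then be cancelled
        because \<open>G\<close> is primitive.\<close>
      have "smult (c * h) V = smult c H * V" using h by simp
      also have "\<dots> = a * G * V + b * (U * V)" unfolding c(5) by (simp add: algebra_simps)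
      also have "\<dots> = G * (a * V + b * W)" unfolding W by (simp add: algebra_simps)
      finally have "smult (c * h) V = G * (a * V + b * W)" .
      then have "dvd_in (polys_over A) G V"
        using c hA W V
        by (intro primitive_dvd_cancel[OF G(1,2), of "c * h" V "a * V + b * W"])
           (auto intro!: mult_mem pol.add_mem pol.mult_mem)
      then show ?thesis by blast
    qed
  qed
  have "\<not> dvd_in (polys_over A) G 1"
  proof
    assume "dvd_in (polys_over A) G 1"
    then obtain Q where "1 = G * Q" by (auto simp: dvd_in_def)
    then have "G dvd 1" by (rule dvdI)
    then have "degree G \<le> degree (1 :: 'a poly)" by (rule dvd_imp_degree_le) simp
    then show False using G by simp
  qed
  then show ?thesis unfolding prime_in_def using main G(1) G0 by blast
qed

text \<open>Induction on the degree. The constant split off factors in \<open>A\<close>; the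
  primitive part is constant, splits into factors of smaller degree, or is prime by
  \<open>indecomposable_prime\<close>.\<close>

theorem factorial_polys_over: "factorial_set (polys_over A)"
proof -
  interpret pol: domain_set "polys_over A" by (rule domain_set_polys_over)
  have "\<exists>n. prime_product_in (polys_over A) n P" if "P \<in> polys_over A" "P \<noteq> 0" for P
    using that
  proof (induction "degree P" arbitrary: P rule: less_induct)
    case less
    obtain c G where c: "c \<in> A" "G \<in> polys_over A" "c \<noteq> 0" "P = smult c G" "primitive G"
      using primitive_part_exists less.prems by blast
    have deg: "degree G = degree P" and G0: "G \<noteq> 0"
      using c less.prems by auto
    have "\<exists>n. prime_product_in (polys_over A) n G"
    proof (cases "degree G = 0")
      case True
      then obtain g where g: "G = [:g:]" by (rule degree_eq_zeroE)
      then have "g \<in> A" "g \<noteq> 0" using c G0 polys_overD[of G A 0] by auto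
      then show ?thesis using g prime_product_exists prime_product_in_const_poly by blast
    next
      case pos: False
      show ?thesis
      proof (cases "\<exists>H\<in>polys_over A. \<exists>K\<in>polys_over A. G = H * K \<and>
                      degree H \<noteq> 0 \<and> degree K \<noteq> 0")
        case True
        then obtain H K where HK: "H \<in> polys_over A" "K \<in> polys_over A" "G = H * K"
          "degree H \<noteq> 0" "degree K \<noteq> 0" by blast
        have nz: "H \<noteq> 0" "K \<noteq> 0" using G0 HK by auto
        then have "degree G = degree H + degree K"
          using HK degree_mult_eq by blast
        then have "degree H < degree P" "degree K < degree P"
          using HK deg by auto
        then show ?thesis
          using less.hyps[OF _ HK(1) nz(1)] less.hyps[OF _ HK(2) nz(2)] HK(3)
            pol.prime_product_in_mult by blast
      next
        case False
        then have "prime_in (polys_over A) G"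
          using pos c by (intro indecomposable_prime) auto
        then have "prime_product_in (polys_over A) (Suc 0) (G * 1)"
          by (intro prime_product_in.intros pol.one_mem dvd_inI[OF pol.one_mem]) auto
        then show ?thesis by auto
      qed
    qed
    moreover obtain n where "prime_product_in A n c" using c prime_product_exists by blast
    ultimately obtain m where "prime_product_in (polys_over A) (n + m) ([:c:] * G)"
      using pol.prime_product_in_mult prime_product_in_const_poly by blast
    then show ?case using c by auto
  qed
  then show ?thesis
    by unfold_locales (auto simp: factorial_in_def)
qed

text \<open>The polynomials vanishing at \<open>t\<close> are saturated because values lie in a
  domain. The generator is a primitive multiple of the minimal polynomial of \<open>t\<close> over
  the fraction field.\<close>

corollary vanishing_ideal_principal:
  assumes "F0 \<in> polys_over A" "F0 \<noteq> 0" "poly F0 t = 0"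
  shows "\<exists>H\<in>polys_over A. poly H t = 0 \<and>
           (\<forall>F\<in>polys_over A. poly F t = 0 \<longrightarrow> dvd_in (polys_over A) H F)"
proof -
  interpret pol: domain_set "polys_over A" by (rule domain_set_polys_over)
  define J where "J = {P\<in>polys_over A. poly P t = 0}"
  have "\<exists>H\<in>J. H \<noteq> 0 \<and> primitive H \<and> (\<forall>F\<in>J. dvd_in (polys_over A) H F)"
    by (rule minimal_degree_generator[of J F0])
       (auto simp: J_def assms intro!: smult_mem pol.diff_mem pol.mult_mem)
  then show ?thesis by (auto simp: J_def)
qed

end

section \<open>Adjoining elements and ring homomorphisms\<close>

text \<open>Covers both evaluation of polynomials at an element and evaluation of functions at a
  point; the zero divisors among functions account for the weak sort of the source.\<close>

locale unital_hom =
  fixes h :: "'a::comm_ring_1 \<Rightarrow> 'b::comm_ring_1"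
  assumes hom_one: "h 1 = 1"
    and hom_add: "h (a + b) = h a + h b"
    and hom_mult: "h (a * b) = h a * h b"
begin

lemma hom_zero [simp]: "h 0 = 0"
  using hom_add[of 0 0] by simp

lemma hom_diff: "h (a - b) = h a - h b"
  using hom_add[of "a - b" b] by (simp add: algebra_simps)

lemma hom_poly: "h (poly P x) = poly (map_poly h P) (h x)"
  by (induction P) (simp_all add: map_poly_pCons hom_add hom_mult)

lemma map_poly_hom_mult: "map_poly h (P * Q) = map_poly h P * map_poly h Q"
proof (rule poly_eqI)
  have hom_sum: "h (sum f I) = (\<Sum>i\<in>I. h (f i))" for f :: "nat \<Rightarrow> 'a" and I
    by (induction I rule: infinite_finite_induct) (auto simp: hom_add)
  show "coeff (map_poly h (P * Q)) n = coeff (map_poly h P * map_poly h Q) n" for n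
    by (simp add: coeff_map_poly coeff_mult hom_sum hom_mult)
qed

lemma map_poly_mem: "P \<in> polys_over A \<Longrightarrow> map_poly h P \<in> polys_over (h ` A)"
  by (auto simp: polys_over_def coeff_map_poly)

lemma map_poly_lift:
  assumes "P \<in> polys_over (h ` A)" "ring_set A"
  shows "\<exists>Q\<in>polys_over A. map_poly h Q = P"
proof -
  interpret ring_set A by fact
  show ?thesis
    using assms(1)
  proof (induction P)
    case 0
    show ?case by (intro bexI[of _ 0]) (auto simp: polys_over_def zero_mem)
  next
    case (pCons a P)
    have "a \<in> h ` A" "P \<in> polys_over (h ` A)"
      using polys_overD[OF pCons.prems, of 0] polys_overD[OF pCons.prems, of "Suc _"]
      by (auto intro: polys_overI)
    then obtain b Q where "b \<in> A" "a = h b" "Q \<in> polys_over A" "map_poly h Q = P"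
      using pCons.IH by auto
    then show ?case
      by (intro bexI[of _ "pCons b Q"]) (auto simp: map_poly_pCons intro: pCons_mem)
  qed
qed

lemma ring_set_image: "ring_set A \<Longrightarrow> ring_set (h ` A)"
  unfolding ring_set_def
  by (auto simp: hom_diff[symmetric] hom_mult[symmetric] hom_one intro: image_eqI[where f = h and x = 1])

lemma inj_on_iff_kernel:
  assumes "ring_set A"
  shows "inj_on h A \<longleftrightarrow> (\<forall>a\<in>A. h a = 0 \<longrightarrow> a = 0)"
proof -
  interpret ring_set A by fact
  show ?thesis
  proof
    assume "inj_on h A"
    then show "\<forall>a\<in>A. h a = 0 \<longrightarrow> a = 0"
      by (metis hom_zero inj_onD zero_mem)
  next
    assume *: "\<forall>a\<in>A. h a = 0 \<longrightarrow> a = 0"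
    show "inj_on h A"
    proof (rule inj_onI)
      fix a b assume "a \<in> A" "b \<in> A" "h a = h b"
      then have "a - b = 0" using bspec[OF *, of "a - b"] diff_mem[of a b] by (simp only: hom_diff) simp
      then show "a = b" by simp
    qed
  qed
qed

end

text \<open>Relative divisibility mentions only elements of the subring, so an injective
  homomorphism carries units, primes and factorisations over.\<close>

lemma factorial_set_image:
  fixes h :: "'a::idom \<Rightarrow> 'b::idom"
  assumes "unital_hom h" "factorial_set A" "inj_on h A"
  shows "factorial_set (h ` A)"
proof -
  interpret unital_hom h by fact
  interpret A: factorial_set A by fact
  interpret B: domain_set "h ` A"
    by (intro domain_set.intro ring_set_image A.ring_set_axioms)
  have eq_iff: "h a = h b \<longleftrightarrow> a = b" if "a \<in> A" "b \<in> A" for a b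
    using that assms(3) by (auto dest: inj_onD)
  have dvd_iff: "dvd_in (h ` A) (h a) (h b) \<longleftrightarrow> dvd_in A a b" if "a \<in> A" "b \<in> A" for a b
    unfolding dvd_in_def using that by (auto simp: hom_mult[symmetric] eq_iff A.mult_mem)
  have prime: "prime_in (h ` A) (h p)" if "prime_in A p" for p
  proof -
    have p: "p \<in> A" "p \<noteq> 0" "\<not> dvd_in A p 1"
      and *: "\<And>a b. a \<in> A \<Longrightarrow> b \<in> A \<Longrightarrow> dvd_in A p (a * b) \<Longrightarrow> dvd_in A p a \<or> dvd_in A p b"
      using that by (auto simp: prime_in_def)
    have "h p \<noteq> 0" using eq_iff[OF p(1) A.zero_mem] p by simp
    moreover have "\<not> dvd_in (h ` A) (h p) 1"
      using dvd_iff[OF p(1) A.one_mem] p by (simp add: hom_one)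
    moreover have "dvd_in (h ` A) (h p) (h a) \<or> dvd_in (h ` A) (h p) (h b)"
      if "a \<in> A" "b \<in> A" "dvd_in (h ` A) (h p) (h a * h b)" for a b
      using that dvd_iff p(1) *[of a b] by (simp add: hom_mult[symmetric] A.mult_mem)
    ultimately show ?thesis
      using p(1) unfolding prime_in_def by blast
  qed
  have product: "prime_product_in (h ` A) n (h a)" if "prime_product_in A n a" for n a
    using that
  proof (induction rule: prime_product_in.induct)
    case (unit u)
    then show ?case using dvd_iff[OF _ A.one_mem] by (auto simp: hom_one intro: prime_product_in.unit)
  next
    case (prime_times p n a)
    then show ?case using prime by (simp add: hom_mult prime_product_in.prime_times)
  qed
  show ?thesis
  proof
    show "factorial_in (h ` A)"
      unfolding factorial_in_def
    proof safe
      fix a assume "a \<in> A" "h a \<noteq> 0"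
      then show "\<exists>n. prime_product_in (h ` A) n (h a)"
        using A.prime_product_exists[of a] product by (metis hom_zero)
    qed
  qed
qed

section \<open>Simple ring extensions\<close>

definition adjoin_elem :: "'a::comm_ring_1 set \<Rightarrow> 'a \<Rightarrow> 'a set" where
  "adjoin_elem A t = (\<lambda>P. poly P t) ` polys_over A"

definition transcendental_over :: "'a::comm_ring_1 set \<Rightarrow> 'a \<Rightarrow> bool" where
  "transcendental_over A t \<longleftrightarrow> (\<forall>P\<in>polys_over A. poly P t = 0 \<longrightarrow> P = 0)"

lemma unital_hom_poly: "unital_hom (\<lambda>P. poly P t)"
  by unfold_locales auto

context ring_set
begin

lemma ring_set_adjoin_elem: "ring_set (adjoin_elem A t)"
  unfolding adjoin_elem_def
  by (intro unital_hom.ring_set_image unital_hom_poly ring_set_polys_over)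

lemma subset_adjoin_elem: "A \<subseteq> adjoin_elem A t"
proof
  fix a assume "a \<in> A"
  then show "a \<in> adjoin_elem A t"
    unfolding adjoin_elem_def by (intro image_eqI[of _ _ "[:a:]"]) (auto intro: const_poly_mem)
qed

lemma mem_adjoin_elem: "t \<in> adjoin_elem A t"
  unfolding adjoin_elem_def
  by (intro image_eqI[of _ _ "[:0, 1:]"]) (auto intro!: pCons_mem zero_mem one_mem const_poly_mem)

lemma adjoin_elem_least: "B \<subseteq> A \<Longrightarrow> t \<in> A \<Longrightarrow> adjoin_elem B t \<subseteq> A"
  unfolding adjoin_elem_def using poly_mem polys_over_mono by blast

text \<open>If \<open>h\<close> kills \<open>poly P t\<close>, transcendence of \<open>h t\<close>
  kills the images of all coefficients of \<open>P\<close>, and injectivity on \<open>A\<close> then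
  kills the coefficients themselves.\<close>

lemma inj_on_adjoin_elem:
  assumes "unital_hom h" "inj_on h A" "transcendental_over (h ` A) (h t)"
  shows "inj_on h (adjoin_elem A t)"
proof -
  interpret unital_hom h by fact
  have "x = 0" if x: "x \<in> adjoin_elem A t" "h x = 0" for x
  proof -
    obtain P where P: "P \<in> polys_over A" "x = poly P t"
      using x by (auto simp: adjoin_elem_def)
    then have "map_poly h P = 0"
      using x assms(3) map_poly_mem[OF P(1)] by (simp add: hom_poly transcendental_over_def)
    then have "h (coeff P k) = 0" for k
      by (metis coeff_0 coeff_map_poly hom_zero)
    then have "coeff P k = 0" for k
      using assms(2) inj_on_iff_kernel[OF ring_set_axioms] polys_overD[OF P(1)] by blast
    then have "P = 0" by (intro poly_eqI) simp
    then show "x = 0" using P by simp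
  qed
  then show ?thesis
    using inj_on_iff_kernel[OF ring_set_adjoin_elem] by blast
qed

lemma image_adjoin_elem:
  assumes "unital_hom h"
  shows "h ` adjoin_elem A t = adjoin_elem (h ` A) (h t)"
proof -
  interpret unital_hom h by fact
  have "polys_over (h ` A) = map_poly h ` polys_over A"
    using map_poly_mem map_poly_lift[OF _ ring_set_axioms] by blast
  then show ?thesis
    unfolding adjoin_elem_def image_image by (simp only: image_image hom_poly)
qed

end

text \<open>Transcendence makes evaluation at \<open>t\<close> an isomorphism from
  \<open>A[X]\<close> onto the extension, along which Gauss's theorem is transported.\<close>

lemma (in factorial_set) factorial_adjoin_elem:
  assumes "transcendental_over A t"
  shows "factorial_set (adjoin_elem A t)"
  unfolding adjoin_elem_def
proof (rule factorial_set_image[OF unital_hom_poly factorial_polys_over])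
  show "inj_on (\<lambda>P. poly P t) (polys_over A)"
    using assms unital_hom.inj_on_iff_kernel[OF unital_hom_poly ring_set_polys_over]
    by (auto simp: transcendental_over_def)
qed

section \<open>Algebraic dependence\<close>

locale field_set = ring_set A for A :: "'a::field set" +
  assumes inverse_mem: "a \<in> A \<Longrightarrow> inverse a \<in> A"
text \<open>Bridge to carrier-based algebra, whose degree theory of finite extensions supplies the
  transitivity of being algebraic.\<close>

abbreviation type_ring :: "'a::field ring" where
  "type_ring \<equiv> ring_of_type_algebra"

lemma type_ring_simps [simp]:
  "carrier type_ring = UNIV" "x \<otimes>\<^bsub>type_ring\<^esub> y = x * y" "x \<oplus>\<^bsub>type_ring\<^esub> y = x + y"
  "\<one>\<^bsub>type_ring\<^esub> = 1" "\<zero>\<^bsub>type_ring\<^esub> = 0"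
  by (simp_all add: ring_of_type_algebra_def)

lemma field_type_ring: "field (type_ring :: 'a::field ring)"
  by (rule field_from_type_algebra)

lemma type_ring_a_inv [simp]: "\<ominus>\<^bsub>type_ring\<^esub> x = - (x :: 'a::field)"
proof -
  interpret field "type_ring :: 'a ring" by (rule field_type_ring)
  show ?thesis using minus_equality[of "- x" x] by simp
qed

lemma type_ring_m_inv: "x \<noteq> 0 \<Longrightarrow> inv\<^bsub>type_ring\<^esub> x = inverse (x :: 'a::field)"
proof -
  interpret field "type_ring :: 'a ring" by (rule field_type_ring)
  show "x \<noteq> 0 \<Longrightarrow> ?thesis" using comm_inv_char[of x "inverse x"] by simp
qed

lemma type_ring_nat_pow [simp]: "x [^]\<^bsub>type_ring\<^esub> (n::nat) = (x :: 'a::field) ^ n"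
proof -
  interpret field "type_ring :: 'a ring" by (rule field_type_ring)
  show ?thesis by (induction n) (simp_all add: mult.commute)
qed

lemma field_set_iff_subfield: "field_set L \<longleftrightarrow> subfield L (type_ring :: 'a::field ring)"
proof -
  interpret R: field "type_ring :: 'a ring" by (rule field_type_ring)
  show ?thesis
  proof
    assume "field_set L"
    then interpret field_set L .
    show "subfield L type_ring"
      by (rule R.subfieldI'[OF R.subringI])
         (auto simp: one_mem uminus_mem mult_mem add_mem type_ring_m_inv inverse_mem)
  next
    assume *: "subfield L type_ring"
    note sub = subringE[OF subfieldE(1)[OF *]]
    show "field_set L"
    proof
      show "1 \<in> L" using sub(3) by simp
      show "a - b \<in> L" if "a \<in> L" "b \<in> L" for a b
        using sub(7)[OF that(1) sub(5)[OF that(2)]] by simp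
      show "a * b \<in> L" if "a \<in> L" "b \<in> L" for a b
        using sub(6)[OF that] by simp
      show "inverse a \<in> L" if "a \<in> L" for a
        using R.subfield_m_inv(1)[OF *, of a] that sub(2) by (cases "a = 0") (auto simp: type_ring_m_inv)
    qed
  qed
qed

lemma algebraic_over_iff:
  assumes "field_set L"
  shows "(ring.algebraic (type_ring :: 'a::field ring) over L) x \<longleftrightarrow> \<not> transcendental_over L x"
proof -
  interpret R: field "type_ring :: 'a ring" by (rule field_type_ring)
  interpret field_set L by fact
  \<comment> \<open>Carrier-based polynomials list the leading coefficient first,
    \<open>Poly\<close> expects the constant term first; hence the reversal.\<close>
  have eval: "R.eval ps x = poly (Poly (rev ps)) x" for ps
    by (induction ps) (simp_all add: Poly_append poly_monom)
  have sub: "subring L type_ring"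
    using assms subfieldE(1) by (simp add: field_set_iff_subfield)
  show ?thesis
  proof
    assume "(R.algebraic over L) x"
    then obtain ps where ps: "ps \<in> carrier (L [X]\<^bsub>type_ring\<^esub>)" "ps \<noteq> []" "R.eval ps x = 0"
      using R.algebraicE[OF sub] by auto
    then have ps': "set ps \<subseteq> L" "hd ps \<noteq> 0"
      by (auto simp: univ_poly_def polynomial_def)
    have co: "coeff (Poly (rev ps)) k = (if k < length ps then rev ps ! k else 0)" for k
      by (simp add: nth_default_def)
    have "coeff (Poly (rev ps)) (length ps - 1) = hd ps"
      using ps(2) unfolding co by (simp add: rev_nth hd_conv_nth)
    then have "Poly (rev ps) \<noteq> 0" using ps'(2) by (metis coeff_0)
    moreover have "Poly (rev ps) \<in> polys_over L"
      using ps'(1) nth_mem[of _ "rev ps"] by (intro polys_overI) (auto simp: nth_default_def zero_mem simp del: nth_mem)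
    ultimately show "\<not> transcendental_over L x"
      using ps(3) eval by (auto simp: transcendental_over_def)
  next
    assume "\<not> transcendental_over L x"
    then obtain P where P: "P \<in> polys_over L" "poly P x = 0" "P \<noteq> 0"
      by (auto simp: transcendental_over_def)
    have "set (coeffs P) \<subseteq> L"
      using P(1) by (auto simp: coeffs_def polys_over_def)
    moreover have "hd (rev (coeffs P)) \<noteq> 0"
      using P(3) by (simp add: hd_rev last_coeffs_eq_coeff_degree)
    ultimately have "rev (coeffs P) \<in> carrier (L [X]\<^bsub>type_ring\<^esub>)"
      by (auto simp: univ_poly_def polynomial_def)
    moreover have "R.eval (rev (coeffs P)) x = \<zero>\<^bsub>type_ring\<^esub>"
      using P(2) by (simp add: eval)
    ultimately show "(R.algebraic over L) x"
      using R.algebraicI[of "rev (coeffs P)" L x] P(3) by auto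
  qed
qed

definition algebraic_closure_in :: "'a::field set \<Rightarrow> 'a set" where
  "algebraic_closure_in L = {x. \<not> transcendental_over L x}"

text \<open>Closedness is relative to the ambient type; \<open>L\<close> need not be algebraically
  closed as an abstract field.\<close>

definition alg_closed_set :: "'a::field set \<Rightarrow> bool" where
  "alg_closed_set L \<longleftrightarrow> field_set L \<and> algebraic_closure_in L \<subseteq> L"

lemma transcendental_over_subset:
  "transcendental_over B x \<Longrightarrow> A \<subseteq> B \<Longrightarrow> transcendental_over A x"
  using polys_over_mono[of A B] by (auto simp: transcendental_over_def)

lemma subset_algebraic_closure_in:
  fixes L :: "'a::field set"
  assumes "field_set L"
  shows "L \<subseteq> algebraic_closure_in L"
proof
  fix a assume "a \<in> L"
  interpret L: field_set L by fact
  have "[:- a, 1:] \<in> polys_over L"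
    using \<open>a \<in> L\<close> by (intro L.pCons_mem L.const_poly_mem L.uminus_mem L.one_mem)
  then have "\<not> transcendental_over L a"
    unfolding transcendental_over_def by (intro notI) (drule bspec, auto)
  then show "a \<in> algebraic_closure_in L" by (simp add: algebraic_closure_in_def)
qed

text \<open>The tower law: the coefficients of an equation for \<open>x\<close> over the closure
  generate a finite extension \<open>E\<close> of \<open>L\<close>. Then \<open>E(x)\<close> is
  finite over \<open>E\<close>, hence over \<open>L\<close>, so \<open>x\<close> is algebraic over
  \<open>L\<close>.\<close>

theorem alg_closed_set_algebraic_closure_in:
  assumes "field_set (L :: 'a::field set)"
  shows "alg_closed_set (algebraic_closure_in L)"
proof -
  interpret R: field "type_ring :: 'a ring" by (rule field_type_ring)
  have L: "subfield L type_ring" using assms field_set_iff_subfield by blast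
  have cl: "algebraic_closure_in L = {x \<in> carrier type_ring. (R.algebraic over L) x}"
    using algebraic_over_iff[OF assms] by (simp add: algebraic_closure_in_def)
  have "x \<in> algebraic_closure_in L" if x: "\<not> transcendental_over (algebraic_closure_in L) x" for x
  proof -
    obtain P where P: "P \<in> polys_over (algebraic_closure_in L)" "poly P x = 0" "P \<noteq> 0"
      using x by (auto simp: transcendental_over_def)
    have alg: "(R.algebraic over L) y" if "y \<in> set (coeffs P)" for y
    proof -
      have "y \<in> range (coeff P)" using that range_coeff by blast
      then have "y \<in> algebraic_closure_in L" using polys_overD[OF P(1)] by auto
      then show ?thesis by (simp add: cl)
    qed
    define E where "E = R.finite_extension L (coeffs P)"
    have E: "subfield E type_ring" "R.finite_dimension L E"
      unfolding E_def using R.finite_extension_is_subfield[OF L _ alg]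
        R.finite_extension_finite_dimension(1)[OF L _ alg] by auto
    have "set (coeffs P) \<subseteq> E"
      unfolding E_def using R.finite_extension_mem[OF subfieldE(1)[OF L]] by simp
    moreover have "0 \<in> E" using subringE(2)[OF subfieldE(1)[OF E(1)]] by simp
    ultimately have "P \<in> polys_over E"
      by (intro polys_overI) (metis coeff_in_coeffs le_degree subsetD P(3))
    then have "(R.algebraic over E) x"
      using algebraic_over_iff[of E x] E(1) P field_set_iff_subfield
      by (auto simp: transcendental_over_def)
    then have "R.finite_dimension E (R.simple_extension E x)"
      using R.finite_dimension_simple_extension[OF E(1)] by simp
    then have "R.finite_dimension L (R.simple_extension E x)"
      using R.telescopic_base_dim(1)[OF L E] by blast
    then have "(R.algebraic over L) x"
      using R.finite_dimension_imp_algebraic[OF L R.simple_extension_is_subring[OF subfieldE(1)[OF E(1)]]]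
        R.simple_extension_mem[OF subfieldE(1)[OF E(1)]] by simp
    then show ?thesis using cl by simp
  qed
  moreover have "field_set (algebraic_closure_in L)"
    unfolding field_set_iff_subfield cl by (rule R.subfield_of_algebraics[OF L])
  ultimately show ?thesis by (auto simp: alg_closed_set_def algebraic_closure_in_def)
qed

section \<open>Fractions inside the ambient field\<close>

definition fractions :: "'a::field set \<Rightarrow> 'a set" where
  "fractions D = {a / b | a b. a \<in> D \<and> b \<in> D \<and> b \<noteq> 0}"

lemma subset_fractions:
  fixes D :: "'a::field set"
  assumes "ring_set D"
  shows "D \<subseteq> fractions D"
proof -
  interpret D: ring_set D by fact
  show ?thesis unfolding fractions_def using D.one_mem by force
qed

lemma field_set_fractions:
  fixes D :: "'a::field set"
  assumes "ring_set D"
  shows "field_set (fractions D)"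
proof -
  interpret D: ring_set D by fact
  have frac: "a / b \<in> fractions D" if "a \<in> D" "b \<in> D" "b \<noteq> 0" for a b
    using that by (auto simp: fractions_def)
  show ?thesis
  proof
    show "1 \<in> fractions D" using frac[OF D.one_mem D.one_mem] by simp
  next
    fix x y assume "x \<in> fractions D" "y \<in> fractions D"
    then obtain a b c d where *: "x = a / b" "a \<in> D" "b \<in> D" "b \<noteq> 0" "y = c / d" "c \<in> D" "d \<in> D" "d \<noteq> 0"
      by (auto simp: fractions_def)
    then have "x - y = (a * d - c * b) / (b * d)" "x * y = (a * c) / (b * d)"
      by (auto simp: field_simps)
    then show "x - y \<in> fractions D" "x * y \<in> fractions D"
      using * by (auto intro!: frac D.diff_mem D.mult_mem)
  next
    fix x assume "x \<in> fractions D"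
    then obtain a b where *: "x = a / b" "a \<in> D" "b \<in> D" "b \<noteq> 0"
      by (auto simp: fractions_def)
    show "inverse x \<in> fractions D"
    proof (cases "a = 0")
      case True
      then show ?thesis using * frac[OF D.zero_mem D.one_mem] by simp
    next
      case False
      then show ?thesis using * frac[of b a] by simp
    qed
  qed
qed

text \<open>A relation over the fractions becomes one over \<open>D\<close> after multiplication by
  the product \<open>c\<close> of the denominators.\<close>

lemma transcendental_over_fractions:
  fixes D :: "'a::field set"
  assumes "ring_set D" "transcendental_over D x"
  shows "transcendental_over (fractions D) x"
  unfolding transcendental_over_def
proof safe
  interpret D: ring_set D by fact
  fix P assume P: "P \<in> polys_over (fractions D)" "poly P x = 0"
  have "\<exists>a b. coeff P k = a / b \<and> a \<in> D \<and> b \<in> D \<and> b \<noteq> 0" for k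
    using polys_overD[OF P(1), of k] by (auto simp: fractions_def)
  then obtain a b where ab: "\<And>k. coeff P k = a k / b k" "\<And>k. a k \<in> D" "\<And>k. b k \<in> D" "\<And>k. b k \<noteq> 0"
    by metis
  define c where "c = (\<Prod>k\<le>degree P. b k)"
  have c0: "c \<noteq> 0" unfolding c_def using ab by simp
  have "c * coeff P k \<in> D" for k
  proof (cases "k \<le> degree P")
    case True
    then have "c = b k * (\<Prod>i\<in>{..degree P} - {k}. b i)"
      unfolding c_def by (intro prod.remove) auto
    then have "c * coeff P k = (\<Prod>i\<in>{..degree P} - {k}. b i) * a k"
      using ab(1)[of k] ab(4)[of k] by simp
    then show ?thesis using ab by (auto intro!: D.mult_mem D.prod_mem)
  next
    case False
    then show ?thesis using D.zero_mem by (simp add: coeff_eq_0)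
  qed
  then have "smult c P \<in> polys_over D" by (auto intro: polys_overI)
  moreover have "poly (smult c P) x = 0" using P by simp
  ultimately have "smult c P = 0" using assms(2) unfolding transcendental_over_def by blast
  then show "P = 0" using c0 by simp
qed

text \<open>This is the algebraic closure of \<open>K(S)\<close> in the ambient field. As an
  intersection it is visibly a closure operator, so that exchange is the main point left to
  prove.\<close>

definition alg_span :: "'a::field set \<Rightarrow> 'a set \<Rightarrow> 'a set" where
  "alg_span K S = \<Inter>{L. alg_closed_set L \<and> K \<union> S \<subseteq> L}"

lemma alg_span_superset:
  shows "K \<subseteq> alg_span K S" "S \<subseteq> alg_span K S"
  by (auto simp: alg_span_def)

lemma alg_span_least: "alg_closed_set L \<Longrightarrow> K \<subseteq> L \<Longrightarrow> S \<subseteq> L \<Longrightarrow> alg_span K S \<subseteq> L"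
  by (auto simp: alg_span_def)

lemma alg_closed_set_alg_span: "alg_closed_set (alg_span K S)"
proof -
  have "field_set (alg_span K S)"
    unfolding alg_span_def
    by unfold_locales
       (auto simp: alg_closed_set_def field_set_def field_set_axioms_def ring_set_def)
  moreover have "algebraic_closure_in (alg_span K S) \<subseteq> alg_span K S"
  proof -
    have "algebraic_closure_in (alg_span K S) \<subseteq> L" if L: "alg_closed_set L" "K \<union> S \<subseteq> L" for L
    proof -
      have "alg_span K S \<subseteq> L" using L by (auto simp: alg_span_def)
      then have "algebraic_closure_in (alg_span K S) \<subseteq> algebraic_closure_in L"
        using transcendental_over_subset by (auto simp: algebraic_closure_in_def)
      then show ?thesis using L by (auto simp: alg_closed_set_def)
    qed
    then show ?thesis unfolding alg_span_def[of K S] by blast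
  qed
  ultimately show ?thesis by (simp add: alg_closed_set_def)
qed

lemma field_set_alg_span: "field_set (alg_span K S)"
  using alg_closed_set_alg_span by (auto simp: alg_closed_set_def)

lemma alg_span_mono: "S \<subseteq> alg_span K T \<Longrightarrow> alg_span K S \<subseteq> alg_span K T"
  by (intro alg_span_least alg_closed_set_alg_span alg_span_superset)

lemma transcendental_over_alg_span_iff: "transcendental_over (alg_span K S) x \<longleftrightarrow> x \<notin> alg_span K S"
proof -
  interpret field_set "alg_span K S" by (rule field_set_alg_span)
  show ?thesis
    using alg_closed_set_alg_span[of K S] subset_algebraic_closure_in[OF field_set_alg_span, of K S]
    by (auto simp: alg_closed_set_def algebraic_closure_in_def)
qed

text \<open>The passage from the abstract span to an actual equation: the closure of the fraction
  field of \<open>D\<close> is one of the fields intersected, so \<open>x\<close> is algebraic over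
  the fractions and, with denominators cleared, over \<open>D\<close>.\<close>

lemma not_transcendental_over_if_alg_span:
  assumes "ring_set D" "K \<union> S \<subseteq> D" "x \<in> alg_span K S"
  shows "\<not> transcendental_over D x"
proof
  interpret D: ring_set D by fact
  assume "transcendental_over D x"
  then have "x \<notin> algebraic_closure_in (fractions D)"
    using transcendental_over_fractions[OF assms(1)] by (simp add: algebraic_closure_in_def)
  moreover have "K \<union> S \<subseteq> algebraic_closure_in (fractions D)"
    using assms(2) subset_fractions[OF assms(1)]
      subset_algebraic_closure_in[OF field_set_fractions[OF assms(1)]] by blast
  ultimately show False
    using assms(3) alg_span_least[OF alg_closed_set_algebraic_closure_in[OF field_set_fractions[OF assms(1)]]]
    by blast
qed

text \<open>A relation between \<open>x\<close> and \<open>y\<close> is read as a polynomial equation for \<open>y\<close> over \<open>L[x]\<close>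
  and, after interchanging the two sums, as one for \<open>x\<close> over \<open>L[y]\<close>.\<close>

lemma alg_span_exchange:
  assumes "y \<in> alg_span K (insert x S)" "y \<notin> alg_span K S"
  shows "x \<in> alg_span K (insert y S)"
proof -
  define L where "L = alg_span K S"
  interpret L: field_set L unfolding L_def by (rule field_set_alg_span)
  have "K \<union> insert x S \<subseteq> adjoin_elem L x"
    using alg_span_superset[where K = K and S = S] L.subset_adjoin_elem L.mem_adjoin_elem
    unfolding L_def by blast
  from not_transcendental_over_if_alg_span[OF L.ring_set_adjoin_elem this assms(1)]
  obtain P where P: "P \<in> polys_over (adjoin_elem L x)" "poly P y = 0" "P \<noteq> 0"
    by (auto simp: transcendental_over_def)
  have "\<exists>Q\<in>polys_over L. coeff P i = poly Q x" for i
    using polys_overD[OF P(1), of i] by (auto simp: adjoin_elem_def)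
  then obtain Q where Q: "\<And>i. Q i \<in> polys_over L" "\<And>i. coeff P i = poly (Q i) x" by metis
  define n where "n = Max ((\<lambda>i. degree (Q i)) ` {..degree P})"
  have n: "degree (Q i) \<le> n" if "i \<le> degree P" for i
    unfolding n_def using that by (intro Max_ge) auto
  define R where "R k = (\<Sum>i\<le>degree P. monom (coeff (Q i) k) i)" for k
  have coR: "coeff (R k) i = (if i \<le> degree P then coeff (Q i) k else 0)" for i k
    by (simp add: R_def coeff_sum)
  have R: "R k \<in> polys_over L" for k
    using Q(1) by (intro polys_overI) (auto simp: coR L.zero_mem polys_overD)
  define T where "T = (\<Sum>k\<le>n. monom (poly (R k) y) k)"
  have coT: "coeff T k = (if k \<le> n then poly (R k) y else 0)" for k
    by (simp add: T_def coeff_sum)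
  have "poly T x = (\<Sum>k\<le>n. \<Sum>i\<le>degree P. coeff (Q i) k * y ^ i * x ^ k)"
    by (simp add: T_def R_def poly_sum poly_monom sum_distrib_right)
  also have "\<dots> = (\<Sum>i\<le>degree P. \<Sum>k\<le>n. coeff (Q i) k * x ^ k * y ^ i)"
    by (subst sum.swap) (simp add: mult_ac)
  also have "\<dots> = (\<Sum>i\<le>degree P. poly (Q i) x * y ^ i)"
  proof (intro sum.cong refl)
    fix i assume "i \<in> {..degree P}"
    then have "poly (Q i) x = (\<Sum>k\<le>n. coeff (Q i) k * x ^ k)"
      unfolding poly_altdef using n[of i]
      by (intro sum.mono_neutral_left) (auto simp: coeff_eq_0)
    then show "(\<Sum>k\<le>n. coeff (Q i) k * x ^ k * y ^ i) = poly (Q i) x * y ^ i"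
      by (simp add: sum_distrib_right)
  qed
  also have "\<dots> = 0"
    using P(2) Q(2) by (simp add: poly_altdef)
  finally have T0: "poly T x = 0" .
  \<comment> \<open>Some \<open>R k\<close> is a non-zero polynomial over \<open>L\<close>, and
    \<open>y\<close> is transcendental over \<open>L\<close>; hence the equation obtained for
    \<open>x\<close> is not trivial.\<close>
  obtain i where i: "i \<le> degree P" "Q i \<noteq> 0"
    using P(3) Q(2)[of "degree P"] by (metis leading_coeff_0_iff order_refl poly_0)
  then have "coeff (Q i) (degree (Q i)) \<noteq> 0" by simp
  then have "R (degree (Q i)) \<noteq> 0" using coR[of "degree (Q i)" i] i by auto
  moreover have "transcendental_over L y"
    using assms(2) by (simp add: L_def transcendental_over_alg_span_iff)
  ultimately have "poly (R (degree (Q i))) y \<noteq> 0"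
    using R unfolding transcendental_over_def by blast
  then have "T \<noteq> 0" using coT[of "degree (Q i)"] n[OF i(1)] by auto
  moreover have "T \<in> polys_over (alg_span K (insert y S))"
  proof -
    interpret M: field_set "alg_span K (insert y S)" by (rule field_set_alg_span)
    have "insert y S \<subseteq> alg_span K (insert y S)" by (rule alg_span_superset)
    then have LM: "L \<subseteq> alg_span K (insert y S)" and y: "y \<in> alg_span K (insert y S)"
      unfolding L_def using alg_span_mono[of S K "insert y S"] by auto
    show ?thesis
    proof (rule polys_overI)
      fix k
      have "poly (R k) y \<in> alg_span K (insert y S)"
        using polys_over_mono[OF LM] R y by (intro M.poly_mem) auto
      then show "coeff T k \<in> alg_span K (insert y S)"
        unfolding coT by (simp add: M.zero_mem)
    qed
  qed
  ultimately have "\<not> transcendental_over (alg_span K (insert y S)) x"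
    using T0 unfolding transcendental_over_def by blast
  then show ?thesis by (simp add: transcendental_over_alg_span_iff)
qed

text \<open>An ordered form of independence: the entries can be adjoined from the end of the list,
  each being new over what is there already, and exchange becomes an induction on the list.\<close>

fun alg_free :: "'a::field set \<Rightarrow> 'a list \<Rightarrow> bool" where
  "alg_free K [] \<longleftrightarrow> True"
| "alg_free K (x # xs) \<longleftrightarrow> x \<notin> alg_span K (set xs) \<and> alg_free K xs"

text \<open>The new \<open>x\<close> replaces one element \<open>u\<close> of the part of
  \<open>T\<close> still in use. By exchange \<open>u\<close> remains in the span, so
  \<open>T\<close> stays spanned while the count is unchanged.\<close>

lemma steinitz_exchange:
  assumes "alg_free K xs" "set xs \<subseteq> alg_span K T" "finite T"
  shows "\<exists>U\<subseteq>T. card U + length xs = card T \<and> T \<subseteq> alg_span K (set xs \<union> U)"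
  using assms
proof (induction xs)
  case Nil
  then show ?case using alg_span_superset(2) by (intro exI[of _ T]) auto
next
  case (Cons x xs)
  then obtain U where U: "U \<subseteq> T" "card U + length xs = card T" "T \<subseteq> alg_span K (set xs \<union> U)"
    by auto
  have finU: "finite U" using U Cons.prems finite_subset by blast
  have x: "x \<in> alg_span K (set xs \<union> U)" "x \<notin> alg_span K (set xs)"
    using Cons.prems alg_span_mono[OF U(3)] by auto
  \<comment> \<open>When the elements of \<open>U\<close> are added one at a time, \<open>u\<close>
    is the one at which \<open>x\<close> enters the span.\<close>
  have "\<exists>V u. V \<subseteq> U \<and> u \<in> U - V \<and> x \<notin> alg_span K (set xs \<union> V) \<and> x \<in> alg_span K (insert u (set xs \<union> V))"
    using finU x
  proof (induction U)
    case empty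
    then show ?case by simp
  next
    case (insert u U)
    show ?case
    proof (cases "x \<in> alg_span K (set xs \<union> U)")
      case True
      then show ?thesis using insert by (metis Diff_iff insertCI subset_insertI2)
    next
      case False
      then show ?thesis
        using insert by (intro exI[of _ U] exI[of _ u]) auto
    qed
  qed
  then obtain V u where V: "V \<subseteq> U" "u \<in> U - V" "x \<notin> alg_span K (set xs \<union> V)"
    "x \<in> alg_span K (insert u (set xs \<union> V))" by blast
  have "u \<in> alg_span K (insert x (set xs \<union> V))"
    using alg_span_exchange[OF V(4,3)] .
  moreover have "insert x (set xs \<union> V) \<subseteq> alg_span K (set (x # xs) \<union> (U - {u}))"
    using V alg_span_superset(2)[where K = K and S = "set (x # xs) \<union> (U - {u})"] by auto
  ultimately have u: "u \<in> alg_span K (set (x # xs) \<union> (U - {u}))"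
    using alg_span_mono by blast
  then have "set xs \<union> U \<subseteq> alg_span K (set (x # xs) \<union> (U - {u}))"
    using alg_span_superset(2)[where K = K and S = "set (x # xs) \<union> (U - {u})"] by auto
  then have "T \<subseteq> alg_span K (set (x # xs) \<union> (U - {u}))"
    using U(3) alg_span_mono by blast
  moreover have "card (U - {u}) + length (x # xs) = card T"
    using V U finU by (simp add: card_Diff_singleton) (metis Suc_pred card_gt_0_iff empty_iff add_Suc_right add_Suc)
  ultimately show ?case using U(1) by (intro exI[of _ "U - {u}"]) auto
qed

lemma alg_free_length_le:
  "alg_free K xs \<Longrightarrow> set xs \<subseteq> alg_span K T \<Longrightarrow> finite T \<Longrightarrow> length xs \<le> card T"
  using steinitz_exchange[of K xs T] by auto

text \<open>Greedy choice of a transcendence basis. Indices are selected rather than values, so that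
  the same choice applies to the functions whose values are the \<open>t i\<close>.\<close>

lemma alg_free_basis:
  "\<exists>js. distinct js \<and> set js \<subseteq> set is \<and> alg_free K (map t js) \<and> t ` set is \<subseteq> alg_span K (t ` set js)"
proof (induction "is")
  case Nil
  show ?case by (intro exI[of _ "[]"]) auto
next
  case (Cons i "is")
  then obtain js where js: "distinct js" "set js \<subseteq> set is" "alg_free K (map t js)"
    "t ` set is \<subseteq> alg_span K (t ` set js)" by blast
  show ?case
  proof (cases "t i \<in> alg_span K (t ` set js)")
    case True
    then show ?thesis using js by (intro exI[of _ js]) auto
  next
    case False
    have sup: "t ` set (i # js) \<subseteq> alg_span K (t ` set (i # js))"
      by (rule alg_span_superset)
    then have "i \<notin> set js" using False alg_span_superset(2)[where K = K and S = "t ` set js"] by auto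
    moreover have "t ` set is \<subseteq> alg_span K (t ` set (i # js))"
      using js(4) alg_span_mono[of "t ` set js" K "t ` set (i # js)"] sup by auto
    ultimately show ?thesis
      using js False sup by (intro exI[of _ "i # js"]) auto
  qed
qed

section \<open>The transcendence degree\<close>

definition monomial_value :: "('v \<Rightarrow>\<^sub>0 nat) \<Rightarrow> ('v \<Rightarrow> 'a::field) \<Rightarrow> 'a" where
  "monomial_value m a = (\<Prod>v\<in>Poly_Mapping.keys m. a v ^ Poly_Mapping.lookup m v)"

lemma monomial_value_superset:
  assumes "finite V" "Poly_Mapping.keys m \<subseteq> V"
  shows "monomial_value m a = (\<Prod>v\<in>V. a v ^ Poly_Mapping.lookup m v)"
  unfolding monomial_value_def using assms
  by (intro prod.mono_neutral_left) (auto simp: in_keys_iff)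

lemma monomial_value_add: "monomial_value (m + n) a = monomial_value m a * monomial_value n a"
proof -
  have "Poly_Mapping.keys (m + n) \<subseteq> Poly_Mapping.keys m \<union> Poly_Mapping.keys n"
    by (rule Poly_Mapping.keys_add)
  then show ?thesis
    by (simp add: monomial_value_superset[of "Poly_Mapping.keys m \<union> Poly_Mapping.keys n"]
        lookup_add power_add prod.distrib)
qed

lemma monomial_value_single: "monomial_value (Poly_Mapping.single v k) a = a v ^ k"
  by (simp add: monomial_value_superset[of "{v}"])

text \<open>Supports change under addition and cancellation; summing over a common larger set avoids
  following them.\<close>

lemma mpoly_value_superset:
  assumes "finite M" "Poly_Mapping.keys p \<subseteq> M"
  shows "mpoly_value p a = (\<Sum>m\<in>M. Poly_Mapping.lookup p m * monomial_value m a)"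
  unfolding mpoly_value_def monomial_value_def[symmetric] using assms
  by (intro sum.mono_neutral_left) (auto simp: in_keys_iff)

lemma mpoly_value_single: "mpoly_value (Poly_Mapping.single m c) a = c * monomial_value m a"
  by (simp add: mpoly_value_superset[of "{m}"])

lemma mpoly_value_add: "mpoly_value (p + q) a = mpoly_value p a + mpoly_value q a"
proof -
  have "Poly_Mapping.keys (p + q) \<subseteq> Poly_Mapping.keys p \<union> Poly_Mapping.keys q"
    by (rule Poly_Mapping.keys_add)
  then show ?thesis
    by (simp add: mpoly_value_superset[of "Poly_Mapping.keys p \<union> Poly_Mapping.keys q"]
        lookup_add distrib_right sum.distrib)
qed

lemma mpoly_value_sum: "mpoly_value (sum p I) a = (\<Sum>i\<in>I. mpoly_value (p i) a)"
  by (induction I rule: infinite_finite_induct) (simp_all add: mpoly_value_add, simp_all add: mpoly_value_def)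

definition mpolys_over :: "'a::field set \<Rightarrow> 'v set \<Rightarrow> (('v \<Rightarrow>\<^sub>0 nat) \<Rightarrow>\<^sub>0 'a) set" where
  "mpolys_over K V = {p. (\<forall>m. Poly_Mapping.lookup p m \<in> K) \<and>
     (\<forall>m\<in>Poly_Mapping.keys p. Poly_Mapping.keys m \<subseteq> V)}"

lemma sum_single_mem_mpolys_over:
  fixes K :: "'a::field set"
  assumes "ring_set K" "\<And>i. i \<in> I \<Longrightarrow> c i \<in> K" "\<And>i. i \<in> I \<Longrightarrow> Poly_Mapping.keys (m i) \<subseteq> V"
  shows "(\<Sum>i\<in>I. Poly_Mapping.single (m i) (c i)) \<in> mpolys_over K V"
proof -
  interpret K: ring_set K by fact
  let ?p = "\<Sum>i\<in>I. Poly_Mapping.single (m i) (c i)"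
  have "Poly_Mapping.lookup ?p n \<in> K" for n
    unfolding lookup_sum using assms(2) by (intro K.sum_mem) (auto simp: lookup_single when_def K.zero_mem)
  moreover have "Poly_Mapping.keys n \<subseteq> V" if "n \<in> Poly_Mapping.keys ?p" for n
  proof -
    have "\<exists>i\<in>I. Poly_Mapping.lookup (Poly_Mapping.single (m i) (c i)) n \<noteq> 0"
      using that sum.not_neutral_contains_not_neutral by (fastforce simp: in_keys_iff lookup_sum)
    then show ?thesis using assms(3) by (auto simp: lookup_single when_def split: if_splits)
  qed
  ultimately show ?thesis by (auto simp: mpolys_over_def)
qed

lemma sum_monomials_mem_mpoly_values:
  fixes K :: "'a::field set"
  assumes "ring_set K" "\<And>i. i \<in> I \<Longrightarrow> c i \<in> K" "\<And>i. i \<in> I \<Longrightarrow> Poly_Mapping.keys (m i) \<subseteq> V"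
  shows "(\<Sum>i\<in>I. c i * monomial_value (m i) a) \<in> (\<lambda>p. mpoly_value p a) ` mpolys_over K V"
proof (rule image_eqI)
  show "(\<Sum>i\<in>I. Poly_Mapping.single (m i) (c i)) \<in> mpolys_over K V"
    using assms by (rule sum_single_mem_mpolys_over)
qed (simp add: mpoly_value_sum mpoly_value_single)

lemma ring_set_mpoly_values:
  fixes K :: "'a::field set"
  assumes "ring_set K"
  shows "ring_set ((\<lambda>p. mpoly_value p a) ` mpolys_over K V)" (is "ring_set ?D")
proof
  interpret K: ring_set K by fact
  note mem = sum_monomials_mem_mpoly_values[OF assms, where V = V and a = a]
  show "1 \<in> ?D"
    using mem[of "{()}" "\<lambda>_. 1" "\<lambda>_. 0"] K.one_mem by (simp add: monomial_value_def)
  fix x y assume "x \<in> ?D" "y \<in> ?D"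
  then obtain p q where p: "x = mpoly_value p a" "p \<in> mpolys_over K V"
    and q: "y = mpoly_value q a" "q \<in> mpolys_over K V" by blast
  let ?M = "Poly_Mapping.keys p \<union> Poly_Mapping.keys q"
  let ?c = Poly_Mapping.lookup
  have "x - y = (\<Sum>m\<in>?M. (?c p m - ?c q m) * monomial_value m a)"
    by (simp add: p q mpoly_value_superset[of ?M] left_diff_distrib sum_subtractf)
  also have "\<dots> \<in> ?D"
    using p q by (intro mem) (auto simp: mpolys_over_def intro: K.diff_mem)
  finally show "x - y \<in> ?D" .
  have "x * y = (\<Sum>(m, n)\<in>Poly_Mapping.keys p \<times> Poly_Mapping.keys q.
      (?c p m * ?c q n) * monomial_value (m + n) a)"
    by (simp add: p q mpoly_value_superset[OF finite_keys order_refl] sum_product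
        sum.cartesian_product monomial_value_add mult_ac)
  also have "\<dots> \<in> ?D"
    unfolding case_prod_beta
  proof (rule mem)
    fix i assume i: "i \<in> Poly_Mapping.keys p \<times> Poly_Mapping.keys q"
    show "?c p (fst i) * ?c q (snd i) \<in> K"
      using p q by (auto simp: mpolys_over_def intro: K.mult_mem)
    have "Poly_Mapping.keys (fst i + snd i) \<subseteq> Poly_Mapping.keys (fst i) \<union> Poly_Mapping.keys (snd i)"
      by (rule Poly_Mapping.keys_add)
    then show "Poly_Mapping.keys (fst i + snd i) \<subseteq> V"
      using p q i by (fastforce simp: mpolys_over_def)
  qed
  finally show "x * y \<in> ?D" .
qed

text \<open>A polynomial relation for \<open>s\<close> over the values in the other variables is
  reassembled into one multivariate relation \<open>p\<close>. As \<open>s\<close> does not occur in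
  the coefficients, distinct pairs \<open>(k, m)\<close> give distinct monomials, so
  \<open>p = 0\<close> makes every coefficient vanish.\<close>

lemma algebraically_independent_transcendental:
  fixes K :: "'a::field set"
  assumes "ring_set K" "algebraically_independent K S" "s \<in> S"
  shows "transcendental_over ((\<lambda>p. mpoly_value p (\<lambda>v. v)) ` mpolys_over K (S - {s})) s"
  unfolding transcendental_over_def
proof safe
  interpret K: ring_set K by fact
  let ?c = Poly_Mapping.lookup and ?V = "S - {s}"
  fix P assume P: "P \<in> polys_over ((\<lambda>p. mpoly_value p (\<lambda>v. v)) ` mpolys_over K ?V)" "poly P s = 0"
  have "\<exists>q\<in>mpolys_over K ?V. coeff P k = mpoly_value q (\<lambda>v. v)" for k
    using polys_overD[OF P(1), of k] by auto
  then obtain q where q: "\<And>k. q k \<in> mpolys_over K ?V" "\<And>k. coeff P k = mpoly_value (q k) (\<lambda>v. v)"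
    by metis
  define I where "I = Sigma {..degree P} (\<lambda>k. Poly_Mapping.keys (q k))"
  have finI: "finite I" by (simp add: I_def)
  define p where "p = (\<Sum>(k, m)\<in>I. Poly_Mapping.single (m + Poly_Mapping.single s k) (?c (q k) m))"
  have vars: "Poly_Mapping.keys m \<subseteq> ?V" if "m \<in> Poly_Mapping.keys (q k)" for k m
    using q(1)[of k] that by (auto simp: mpolys_over_def)
  have "p \<in> mpolys_over K S"
    unfolding p_def case_prod_beta
  proof (rule sum_single_mem_mpolys_over[OF assms(1)])
    fix i assume i: "i \<in> I"
    show "?c (q (fst i)) (snd i) \<in> K" using q(1)[of "fst i"] by (auto simp: mpolys_over_def)
    have "Poly_Mapping.keys (snd i + Poly_Mapping.single s (fst i)) \<subseteq>
        Poly_Mapping.keys (snd i) \<union> Poly_Mapping.keys (Poly_Mapping.single s (fst i))"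
      by (rule Poly_Mapping.keys_add)
    also have "\<dots> \<subseteq> S" using i vars[of "snd i" "fst i"] assms(3) by (auto simp: I_def)
    finally show "Poly_Mapping.keys (snd i + Poly_Mapping.single s (fst i)) \<subseteq> S" .
  qed
  moreover have "mpoly_value p (\<lambda>v. v) = 0"
  proof -
    have "mpoly_value p (\<lambda>v. v) = (\<Sum>(k, m)\<in>I. ?c (q k) m * monomial_value m (\<lambda>v. v) * s ^ k)"
      unfolding p_def mpoly_value_sum
      by (intro sum.cong) (auto simp: mpoly_value_single monomial_value_add monomial_value_single)
    also have "\<dots> = (\<Sum>k\<le>degree P. mpoly_value (q k) (\<lambda>v. v) * s ^ k)"
      unfolding I_def
      by (simp add: sum.Sigma[symmetric] mpoly_value_superset[OF finite_keys order_refl] sum_distrib_right)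
    also have "\<dots> = poly P s" by (simp add: poly_altdef q(2))
    finally show ?thesis using P by simp
  qed
  ultimately have "p = 0"
    using assms(2) by (auto simp: algebraically_independent_def mpolys_over_def)
  have "?c (q k) m = 0" if "(k, m) \<in> I" for k m
  proof -
    have s0: "?c n s = 0" if "(j, n) \<in> I" for j n
      using vars[of n j] that by (auto simp: I_def in_keys_iff)
    \<comment> \<open>The exponent of \<open>s\<close> recovers \<open>k\<close>, and the rest of
      the monomial then recovers \<open>m\<close>.\<close>
    have "j = k \<and> n = m" if "(j, n) \<in> I" "n + Poly_Mapping.single s j = m + Poly_Mapping.single s k" for j n
    proof -
      have "?c (n + Poly_Mapping.single s j) s = ?c (m + Poly_Mapping.single s k) s"
        using that by simp
      then have "j = k" using s0[OF that(1)] s0[OF \<open>(k, m) \<in> I\<close>] by (simp add: lookup_add)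
      then show ?thesis using that by simp
    qed
    then have "?c p (m + Poly_Mapping.single s k) = (\<Sum>i\<in>I. if i = (k, m) then ?c (q k) m else 0)"
      unfolding p_def lookup_sum
      by (intro sum.cong) (auto simp: lookup_single when_def split: if_splits)
    also have "\<dots> = ?c (q k) m" using that finI by simp
    finally show ?thesis using \<open>p = 0\<close> by simp
  qed
  then have "q k = 0" if "k \<le> degree P" for k
    using that by (intro poly_mapping_eqI) (auto simp: I_def in_keys_iff)
  then have "coeff P (degree P) = 0" using q(2) by (simp add: mpoly_value_def)
  then show "P = 0" by simp
qed

lemma algebraically_independent_not_mem_alg_span:
  fixes K :: "'a::field set"
  assumes "ring_set K" "algebraically_independent K S" "s \<in> S"
  shows "s \<notin> alg_span K (S - {s})"
proof
  assume "s \<in> alg_span K (S - {s})"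
  moreover have "K \<union> (S - {s}) \<subseteq> (\<lambda>p. mpoly_value p (\<lambda>v. v)) ` mpolys_over K (S - {s})"
  proof -
    interpret K: ring_set K by fact
    note mem = sum_monomials_mem_mpoly_values[OF assms(1), where V = "S - {s}" and a = "\<lambda>v. v"]
    have "x \<in> (\<lambda>p. mpoly_value p (\<lambda>v. v)) ` mpolys_over K (S - {s})" if "x \<in> K" for x
      using mem[of "{()}" "\<lambda>_. x" "\<lambda>_. 0"] that by (simp add: monomial_value_def)
    moreover have "x \<in> (\<lambda>p. mpoly_value p (\<lambda>v. v)) ` mpolys_over K (S - {s})" if "x \<in> S - {s}" for x
      using mem[of "{()}" "\<lambda>_. 1" "\<lambda>_. Poly_Mapping.single x 1"] that K.one_mem
      by (simp add: monomial_value_single)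
    ultimately show ?thesis by blast
  qed
  ultimately show False
    using not_transcendental_over_if_alg_span[OF ring_set_mpoly_values[OF assms(1)]]
      algebraically_independent_transcendental[OF assms] by blast
qed

text \<open>The upper bound to be set against the lower bound of Schanuel's conjecture. An
  independent set, listed in any order, is \<open>alg_free\<close>, so exchange bounds its
  size.\<close>

lemma transcendence_degree_le_card:
  fixes K :: "'a::field set"
  assumes "ring_set K" "L \<subseteq> alg_span K T" "finite T"
  shows "transcendence_degree K L \<le> enat (card T)"
  unfolding transcendence_degree_def
proof (rule Sup_least, safe)
  fix S assume S: "finite S" "S \<subseteq> L" "algebraically_independent K S"
  obtain xs where xs: "set xs = S" "distinct xs"
    using S(1) finite_distinct_list by blast
  have "alg_free K ys" if "distinct ys" "set ys \<subseteq> S" for ys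
    using that
  proof (induction ys)
    case (Cons y ys)
    have "set ys \<subseteq> alg_span K (S - {y})"
      using Cons.prems alg_span_superset(2)[where K = K and S = "S - {y}"] by auto
    then have "alg_span K (set ys) \<subseteq> alg_span K (S - {y})" by (rule alg_span_mono)
    then show ?case
      using Cons algebraically_independent_not_mem_alg_span[OF assms(1) S(3), of y] by auto
  qed simp
  then have "length xs \<le> card T"
    using xs S assms by (intro alg_free_length_le[of K xs T]) auto
  then show "enat (card S) \<le> enat (card T)"
    using xs distinct_card by fastforce
qed

lemma field_adjoin_subset_alg_span:
  fixes K :: "'a::field set"
  assumes "Y \<subseteq> alg_span K T"
  shows "field_adjoin K Y \<subseteq> alg_span K T"
proof -
  interpret R: field "type_ring :: 'a ring" by (rule field_type_ring)
  show ?thesis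
    unfolding field_adjoin_def
    using assms field_set_alg_span[of K T] alg_span_superset(1)[where K = K and S = T]
    by (intro R.generate_field_min_subfield1) (auto simp: field_set_iff_subfield)
qed

section \<open>Exponential polynomials\<close>

text \<open>The algebraic numbers are the relative closure of \<rat>, so the general theorem on
  closures applies.\<close>

lemma field_set_algebraic_numbers: "field_set algebraic_numbers"
proof -
  have "field_set (\<rat> :: complex set)"
    by unfold_locales auto
  moreover have "algebraic_numbers = algebraic_closure_in (\<rat> :: complex set)"
    by (auto simp: algebraic_numbers_def algebraic_closure_in_def algebraic_altdef
        transcendental_over_def polys_over_def)
  ultimately show ?thesis
    using alg_closed_set_algebraic_closure_in unfolding alg_closed_set_def by metis
qed

section \<open>Linear algebra over \<rat>\<close>

lemma vector_space_rat_complex: "vector_space (\<lambda>(q::rat) (z::complex). of_rat q * z)"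
  by unfold_locales (simp_all add: algebra_simps of_rat_add of_rat_mult)

text \<open>Multiplication by \<open>c\<close> is \<rat>-linear and injective. It is applied to the
  reciprocal of a common denominator and to \<open>\<xi>\<close>.\<close>

lemma rat_independent_scale:
  fixes c :: complex
  assumes "finite B" "c \<noteq> 0"
    and "\<not> Modules.module.dependent (\<lambda>(q::rat) (z::complex). of_rat q * z) B"
  shows "\<not> Modules.module.dependent (\<lambda>(q::rat) (z::complex). of_rat q * z) ((*) c ` B)"
proof
  interpret V: vector_space "\<lambda>(q::rat) (z::complex). of_rat q * z" by (rule vector_space_rat_complex)
  have inj: "inj_on ((*) c) B" using assms(2) by (auto intro: inj_onI)
  assume "V.dependent ((*) c ` B)"
  then obtain u where u: "\<exists>v\<in>B. u (c * v) \<noteq> 0" "(\<Sum>v\<in>(*) c ` B. of_rat (u v) * v) = 0"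
    using V.dependent_finite[of "(*) c ` B"] assms(1) by auto
  have "c * (\<Sum>v\<in>B. of_rat (u (c * v)) * v) = (\<Sum>v\<in>(*) c ` B. of_rat (u v) * v)"
    unfolding sum.reindex[OF inj] sum_distrib_left by (intro sum.cong) auto
  then have "(\<Sum>v\<in>B. of_rat (u (c * v)) * v) = 0"
    using u(2) assms(2) by simp
  then have "V.dependent B"
    using u(1) V.dependent_finite[OF assms(1)] by (auto intro!: exI[of _ "\<lambda>v. u (c * v)"])
  then show False using assms(3) by blast
qed

text \<open>A maximal \<rat>-independent subset of \<open>E\<close> gives rational coordinates;
  dividing its members by a common denominator of all coordinates makes these integral.\<close>

lemma exists_integral_basis:
  fixes E :: "complex set"
  assumes "finite E" "field_set K" "E \<subseteq> K"
  shows "\<exists>n b. rat_linearly_independent n b \<and> (\<forall>i\<in>{1..n}. b i \<in> K) \<and>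
           (\<forall>\<beta>\<in>E. \<exists>z::nat \<Rightarrow> int. \<beta> = (\<Sum>i=1..n. of_int (z i) * b i))"
proof -
  interpret V: vector_space "\<lambda>(q::rat) (z::complex). of_rat q * z" by (rule vector_space_rat_complex)
  interpret K: field_set K by fact
  obtain B where B: "B \<subseteq> E" "V.independent B" "E \<subseteq> V.span B"
    using V.maximal_independent_subset by blast
  have finB: "finite B" using B assms finite_subset by blast
  have "\<exists>u. e = (\<Sum>v\<in>B. of_rat (u v) * v)" if "e \<in> E" for e
    using that B(3) V.span_finite[OF finB] by auto
  then obtain r where r: "\<And>e. e \<in> E \<Longrightarrow> e = (\<Sum>v\<in>B. of_rat (r e v) * v)" by metis
  define den where "den e v = snd (quotient_of (r e v))" for e v
  define d where "d = (\<Prod>(e, v)\<in>E \<times> B. den e v)"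
  have den: "den e v > 0" "\<exists>k. of_int (den e v) * r e v = of_int k" for e v
  proof -
    obtain p q where pq: "quotient_of (r e v) = (p, q)" by fastforce
    show "den e v > 0" using quotient_of_denom_pos[OF pq] by (simp add: den_def pq)
    have "r e v = of_int p / of_int q" using quotient_of_div[OF pq] .
    then have "of_int (den e v) * r e v = of_int p"
      using quotient_of_denom_pos[OF pq] unfolding den_def pq snd_conv by simp
    then show "\<exists>k. of_int (den e v) * r e v = of_int k" ..
  qed
  have d: "d > 0" unfolding d_def using den(1) by (auto intro: prod_pos)
  have "\<exists>k. of_int d * r e v = of_int k" if "e \<in> E" "v \<in> B" for e v
  proof -
    have "d = den e v * (\<Prod>(e, v)\<in>E \<times> B - {(e, v)}. den e v)"
      unfolding d_def using that assms(1) finB by (subst prod.remove[of _ "(e, v)"]) auto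
    moreover obtain k where "of_int (den e v) * r e v = of_int k" using den(2) by blast
    ultimately have "of_int d * r e v = of_int (k * (\<Prod>(e, v)\<in>E \<times> B - {(e, v)}. den e v))"
      by (simp only: of_int_mult) (simp add: mult_ac)
    then show ?thesis by blast
  qed
  then obtain z where z: "\<And>e v. e \<in> E \<Longrightarrow> v \<in> B \<Longrightarrow> of_int d * r e v = of_int (z e v)" by metis
  let ?n = "card B"
  obtain h where h: "bij_betw h {1..?n} B" using ex_bij_betw_nat_finite_1[OF finB] by blast
  \<comment> \<open>Dividing the basis by \<open>d\<close> turns a coordinate \<open>r\<close> into
    the integer \<open>d * r\<close>.\<close>
  define c :: complex where "c = inverse (of_int d)"
  have c: "c \<noteq> 0" "c * of_int d = 1" using d by (auto simp: c_def)
  define b where "b i = c * h i" for i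
  have "b ` {1..?n} = (*) c ` h ` {1..?n}"
    unfolding b_def image_image ..
  then have "b ` {1..?n} = (*) c ` B"
    using bij_betw_imp_surj_on[OF h] by simp
  moreover have "inj_on b {1..?n}"
  proof (rule inj_onI)
    fix i j assume "i \<in> {1..?n}" "j \<in> {1..?n}" "b i = b j"
    moreover from this have "h i = h j" using c(1) by (auto simp: b_def)
    ultimately show "i = j" using bij_betw_imp_inj_on[OF h] by (auto dest: inj_onD)
  qed
  ultimately have "rat_linearly_independent ?n b"
    using rat_independent_scale[OF finB c(1) B(2)] by (simp add: rat_linearly_independent_def)
  moreover have "\<forall>i\<in>{1..?n}. b i \<in> K"
  proof
    fix i assume "i \<in> {1..?n}"
    then have "h i \<in> K" using bij_betwE[OF h] B(1) assms(3) by blast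
    moreover have "of_int d \<in> K"
    proof -
      have "of_nat m \<in> K" for m by (induction m) (auto intro: K.zero_mem K.add_mem K.one_mem)
      from this[of "nat d"] show ?thesis using d by simp
    qed
    ultimately show "b i \<in> K" unfolding b_def c_def by (intro K.mult_mem K.inverse_mem)
  qed
  moreover have "\<exists>z::nat \<Rightarrow> int. \<beta> = (\<Sum>i=1..?n. of_int (z i) * b i)" if "\<beta> \<in> E" for \<beta>
  proof (intro exI)
    have "of_rat (r \<beta> v) = c * of_int (z \<beta> v)" if "v \<in> B" for v
    proof -
      have "of_rat (of_int d * r \<beta> v) = (of_rat (of_int (z \<beta> v)) :: complex)"
        using z[OF \<open>\<beta> \<in> E\<close> that] by simp
      then have "of_int d * of_rat (r \<beta> v) = (of_int (z \<beta> v) :: complex)"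
        by (simp add: of_rat_mult)
      then have "c * (of_int d * of_rat (r \<beta> v)) = c * of_int (z \<beta> v)" by simp
      then show ?thesis using c(2) by (simp only: mult.assoc[symmetric]) simp
    qed
    then have "(\<Sum>v\<in>B. of_rat (r \<beta> v) * v) = (\<Sum>v\<in>B. of_int (z \<beta> v) * (c * v))"
      by (intro sum.cong) simp_all
    then have "\<beta> = (\<Sum>v\<in>B. of_int (z \<beta> v) * (c * v))"
      using r[OF that] by simp
    also have "\<dots> = (\<Sum>i=1..?n. of_int (z \<beta> (h i)) * b i)"
      unfolding b_def using sum.reindex_bij_betw[OF h, of "\<lambda>v. of_int (z \<beta> v) * (c * v)"] by simp
    finally show "\<beta> = (\<Sum>i=1..?n. of_int (z \<beta> (h i)) * b i)" .
  qed
  ultimately show ?thesis by blast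
qed

section \<open>The pointwise ring of exponential polynomials\<close>

lemma sum_fun_apply: "(\<Sum>i\<in>I. f i) x = (\<Sum>i\<in>I. f i x)"
  for f :: "'i \<Rightarrow> 'a \<Rightarrow> 'b::comm_monoid_add"
  by (induction I rule: infinite_finite_induct) auto

lemma prod_fun_apply: "(\<Prod>i\<in>I. f i) x = (\<Prod>i\<in>I. f i x)"
  for f :: "'i \<Rightarrow> 'a \<Rightarrow> 'b::comm_monoid_mult"
  by (induction I rule: infinite_finite_induct) auto

lemma power_fun_apply: "(f ^ n) x = f x ^ n"
  for f :: "'a \<Rightarrow> 'b::monoid_mult"
  by (induction n) auto

lemma unital_hom_apply: "unital_hom (\<lambda>f :: 'a \<Rightarrow> 'b::comm_ring_1. f x)"
  by unfold_locales auto

lemma exponential_polynomial_sum: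
  assumes "finite I" "\<And>i. i \<in> I \<Longrightarrow> P i \<in> polys_over algebraic_numbers"
    and "\<And>i. i \<in> I \<Longrightarrow> \<beta> i \<in> algebraic_numbers"
  shows "exponential_polynomial (\<lambda>x. \<Sum>i\<in>I. poly (P i) x * exp (\<beta> i * x))"
proof (cases "I = {}")
  \<comment> \<open>The definition demands at least one summand, so the empty sum is written as a
    single zero term.\<close>
  case True
  interpret K: field_set algebraic_numbers by (rule field_set_algebraic_numbers)
  show ?thesis
    unfolding exponential_polynomial_def
    by (intro exI[of _ 1] exI[of _ "\<lambda>_. 0"]) (auto simp: True K.zero_mem)
next
  case False
  obtain h where h: "bij_betw h {1..card I} I" using ex_bij_betw_nat_finite_1[OF assms(1)] by blast
  have "card I \<ge> 1" using False assms(1) by (simp add: Suc_le_eq card_gt_0_iff)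
  moreover have "h i \<in> I" if "i \<in> {1..card I}" for i using h that bij_betwE by blast
  moreover have "(\<Sum>i\<in>I. poly (P i) x * exp (\<beta> i * x)) =
      (\<Sum>i=1..card I. poly (P (h i)) x * exp (\<beta> (h i) * x))" for x
    using sum.reindex_bij_betw[OF h, of "\<lambda>i. poly (P i) x * exp (\<beta> i * x)"] by simp
  ultimately show ?thesis
    unfolding exponential_polynomial_def using assms(2,3)
    by (intro exI[of _ "card I"] exI[of _ "P \<circ> h"] exI[of _ "\<beta> \<circ> h"]) (auto intro: polys_overD)
qed

lemma exponential_polynomialE:
  assumes "exponential_polynomial f"
  obtains N :: nat and P \<beta> where "\<And>i. i \<in> {1..N} \<Longrightarrow> P i \<in> polys_over algebraic_numbers"
    "\<And>i. i \<in> {1..N} \<Longrightarrow> \<beta> i \<in> algebraic_numbers"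
    "f = (\<lambda>x. \<Sum>i=1..N. poly (P i) x * exp (\<beta> i * x))"
  using assms unfolding exponential_polynomial_def polys_over_def by blast

lemma exponential_polynomial_basic:
  assumes "P \<in> polys_over algebraic_numbers" "\<beta> \<in> algebraic_numbers"
  shows "exponential_polynomial (\<lambda>x. poly P x * exp (\<beta> * x))"
  using exponential_polynomial_sum[of "{()}" "\<lambda>_. P" "\<lambda>_. \<beta>"] assms by simp

lemma ring_set_exponential_polynomials: "ring_set {f. exponential_polynomial f}"
proof
  interpret K: field_set algebraic_numbers by (rule field_set_algebraic_numbers)
  interpret pol: ring_set "polys_over algebraic_numbers :: complex poly set" by (rule K.ring_set_polys_over)
  have "exponential_polynomial (\<lambda>x. poly 1 x * exp (0 * x))"
    by (intro exponential_polynomial_basic pol.one_mem K.zero_mem)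
  then show "1 \<in> {f. exponential_polynomial f}" by (simp add: one_fun_def)
  fix f g assume "f \<in> {f. exponential_polynomial f}" "g \<in> {f. exponential_polynomial f}"
  then have "exponential_polynomial f" "exponential_polynomial g" by auto
  from this(1) obtain N :: nat and P \<beta> where f: "\<And>i. i \<in> {1..N} \<Longrightarrow> P i \<in> polys_over algebraic_numbers"
    "\<And>i. i \<in> {1..N} \<Longrightarrow> \<beta> i \<in> algebraic_numbers"
    "f = (\<lambda>x. \<Sum>i=1..N. poly (P i) x * exp (\<beta> i * x))"
    by (rule exponential_polynomialE) blast
  from \<open>exponential_polynomial g\<close> obtain M :: nat and Q \<gamma>
    where g: "\<And>i. i \<in> {1..M} \<Longrightarrow> Q i \<in> polys_over algebraic_numbers"
    "\<And>i. i \<in> {1..M} \<Longrightarrow> \<gamma> i \<in> algebraic_numbers"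
    "g = (\<lambda>x. \<Sum>i=1..M. poly (Q i) x * exp (\<gamma> i * x))"
    by (rule exponential_polynomialE) blast
  \<comment> \<open>The difference is a sum over the disjoint union of the index sets, the product
    one over their Cartesian product.\<close>
  have "exponential_polynomial (\<lambda>x. \<Sum>i\<in>{1..N} <+> {1..M}.
      poly (case_sum P (\<lambda>j. - Q j) i) x * exp (case_sum \<beta> \<gamma> i * x))"
    by (intro exponential_polynomial_sum) (auto simp: f g pol.uminus_mem)
  also have "(\<lambda>x. \<Sum>i\<in>{1..N} <+> {1..M}.
      poly (case_sum P (\<lambda>j. - Q j) i) x * exp (case_sum \<beta> \<gamma> i * x)) = f - g"
    by (auto simp: fun_eq_iff f g sum.Plus sum_negf)
  finally show "f - g \<in> {f. exponential_polynomial f}" unfolding mem_Collect_eq .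
  have "exponential_polynomial (\<lambda>x. \<Sum>i\<in>{1..N} \<times> {1..M}.
      poly (P (fst i) * Q (snd i)) x * exp ((\<beta> (fst i) + \<gamma> (snd i)) * x))"
    by (intro exponential_polynomial_sum) (auto simp: f g pol.mult_mem K.add_mem)
  also have "(\<lambda>x. \<Sum>i\<in>{1..N} \<times> {1..M}.
      poly (P (fst i) * Q (snd i)) x * exp ((\<beta> (fst i) + \<gamma> (snd i)) * x)) = f * g"
    by (simp add: fun_eq_iff f g sum_product sum.cartesian_product case_prod_beta exp_add
        distrib_left distrib_right mult_ac)
  finally show "f * g \<in> {f. exponential_polynomial f}" unfolding mem_Collect_eq .
qed

text \<open>Elements of the extension are values at \<open>g\<close> of polynomials over
  \<open>A\<close>, possibly in several ways. Injectivity on \<open>A\<close> identifies these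
  polynomials with those over the image of \<open>A\<close>, where the ideal vanishing at
  \<open>h g\<close> is principal. A factorisation there lifts to an identity over \<open>A\<close>,
  and substituting \<open>g\<close> yields the quotient.\<close>

lemma (in ring_set) kernel_on_adjoin_elem_principal:
  fixes h :: "'a \<Rightarrow> 'b::idom"
  assumes "unital_hom h" "inj_on h A" "factorial_set (h ` A)"
    and F0: "F0 \<in> adjoin_elem A g" "F0 \<noteq> 0" "h F0 = 0"
  shows "\<exists>f\<in>adjoin_elem A g. h f = 0 \<and>
           (\<forall>F\<in>adjoin_elem A g. h F = 0 \<longrightarrow> (\<exists>q\<in>adjoin_elem A g. F = f * q))"
proof -
  interpret unital_hom h by fact
  interpret B: factorial_set "h ` A" by fact
  interpret pol: ring_set "polys_over A" by (rule ring_set_polys_over)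
  have inj: "P = Q" if "P \<in> polys_over A" "Q \<in> polys_over A" "map_poly h P = map_poly h Q" for P Q
  proof (rule poly_eqI)
    fix k
    have "h (coeff P k) = h (coeff Q k)"
      using arg_cong[OF that(3), of "\<lambda>P. coeff P k"] by (simp add: coeff_map_poly)
    then show "coeff P k = coeff Q k"
      using that(1,2) assms(2) by (auto simp: polys_over_def dest: inj_onD)
  qed
  obtain P0 where P0: "P0 \<in> polys_over A" "F0 = poly P0 g" using F0(1) by (auto simp: adjoin_elem_def)
  have "P0 \<noteq> 0" using F0(2) P0(2) by auto
  then have "map_poly h P0 \<noteq> 0" using inj[OF P0(1) pol.zero_mem] by auto
  moreover have "poly (map_poly h P0) (h g) = 0" using F0(3) P0(2) by (simp add: hom_poly)
  ultimately obtain H where H: "H \<in> polys_over (h ` A)" "poly H (h g) = 0"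
    "\<And>F. F \<in> polys_over (h ` A) \<Longrightarrow> poly F (h g) = 0 \<Longrightarrow> dvd_in (polys_over (h ` A)) H F"
    using B.vanishing_ideal_principal[OF map_poly_mem[OF P0(1)]] by blast
  obtain H' where H': "H' \<in> polys_over A" "map_poly h H' = H"
    using map_poly_lift[OF H(1) ring_set_axioms] by blast
  have "\<exists>q\<in>adjoin_elem A g. F = poly H' g * q" if F: "F \<in> adjoin_elem A g" "h F = 0" for F
  proof -
    obtain P where P: "P \<in> polys_over A" "F = poly P g" using F by (auto simp: adjoin_elem_def)
    have "dvd_in (polys_over (h ` A)) H (map_poly h P)"
      using F P by (intro H(3) map_poly_mem) (auto simp: hom_poly)
    then obtain Q where Q: "Q \<in> polys_over (h ` A)" "map_poly h P = H * Q"
      by (auto simp: dvd_in_def)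
    obtain Q' where Q': "Q' \<in> polys_over A" "map_poly h Q' = Q"
      using map_poly_lift[OF Q(1) ring_set_axioms] by blast
    \<comment> \<open>It suffices to compare the images of the coefficients under \<open>h\<close>,
      where this is the divisibility just found.\<close>
    have "P = H' * Q'"
      using P Q Q' H' by (intro inj pol.mult_mem) (auto simp: map_poly_hom_mult)
    then show ?thesis
      using P Q' by (intro bexI[of _ "poly Q' g"]) (auto simp: adjoin_elem_def)
  qed
  moreover have "poly H' g \<in> adjoin_elem A g" "h (poly H' g) = 0"
    using H H' by (auto simp: adjoin_elem_def hom_poly)
  ultimately show ?thesis by blast
qed

section \<open>Zeros under Schanuel's conjecture\<close>

lemma factorial_set_field:
  assumes "field_set (K :: 'a::field set)"
  shows "factorial_set K"
proof -
  interpret field_set K by fact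
  have "prime_product_in K 0 a" if "a \<in> K" "a \<noteq> 0" for a
    using that by (intro prime_product_in.unit dvd_inI[OF inverse_mem]) auto
  then show ?thesis
    by unfold_locales (auto simp: factorial_in_def)
qed

text \<open>\<open>foldr\<close> adjoins the last entry first, so each entry extends the ring
  generated by those after it, in accordance with \<open>alg_free\<close>.\<close>

definition adjoin_list :: "'a::comm_ring_1 set \<Rightarrow> 'a list \<Rightarrow> 'a set" where
  "adjoin_list A gs = foldr (\<lambda>g B. adjoin_elem B g) gs A"

lemma ring_set_adjoin_list:
  assumes "ring_set A"
  shows "ring_set (adjoin_list A gs)" "A \<subseteq> adjoin_list A gs" "set gs \<subseteq> adjoin_list A gs"
proof -
  have "ring_set (adjoin_list A gs) \<and> A \<subseteq> adjoin_list A gs \<and> set gs \<subseteq> adjoin_list A gs"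
  proof (induction gs)
    case Nil
    then show ?case using assms by (simp add: adjoin_list_def)
  next
    case (Cons g gs)
    then interpret ring_set "adjoin_list A gs" by simp
    have "adjoin_list A (g # gs) = adjoin_elem (adjoin_list A gs) g" by (simp add: adjoin_list_def)
    then show ?case
      using Cons ring_set_adjoin_elem subset_adjoin_elem[of g] mem_adjoin_elem[of g] by auto
  qed
  then show "ring_set (adjoin_list A gs)" "A \<subseteq> adjoin_list A gs" "set gs \<subseteq> adjoin_list A gs" by auto
qed

lemma adjoin_list_least:
  assumes "ring_set B" "A \<subseteq> B" "set gs \<subseteq> B"
  shows "adjoin_list A gs \<subseteq> B"
  using assms(3)
proof (induction gs)
  case Nil
  then show ?case using assms(2) by (simp add: adjoin_list_def)
next
  case (Cons g gs)
  then show ?case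
    using ring_set.adjoin_elem_least[OF assms(1), of "adjoin_list A gs" g] by (simp add: adjoin_list_def)
qed

text \<open>Both claims follow one generator at a time: the image ring lies in the span of the
  values already adjoined, over which the next value is transcendental.\<close>

lemma adjoin_list_alg_free:
  fixes h :: "'a::comm_ring_1 \<Rightarrow> 'b::field"
  assumes "unital_hom h" "ring_set A" "inj_on h A" "h ` A = K" "field_set K" "alg_free K (map h gs)"
  shows "inj_on h (adjoin_list A gs)" "factorial_set (h ` adjoin_list A gs)"
proof -
  interpret unital_hom h by fact
  have "inj_on h (adjoin_list A gs) \<and> factorial_set (h ` adjoin_list A gs)"
    using assms(6)
  proof (induction gs)
    case Nil
    then show ?case using assms factorial_set_field by (simp add: adjoin_list_def)
  next
    case (Cons g gs)
    let ?R = "adjoin_list A gs"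
    interpret R: ring_set ?R using ring_set_adjoin_list(1)[OF assms(2)] .
    interpret B: factorial_set "h ` ?R" using Cons by simp
    have eq: "adjoin_list A (g # gs) = adjoin_elem ?R g" by (simp add: adjoin_list_def)
    have "h ` ?R \<subseteq> alg_span K (h ` set gs)"
    proof -
      interpret L: field_set "alg_span K (h ` set gs)" by (rule field_set_alg_span)
      have "ring_set {f. h f \<in> alg_span K (h ` set gs)}"
        by unfold_locales (auto simp: hom_one hom_diff hom_mult L.one_mem L.diff_mem L.mult_mem)
      then have "?R \<subseteq> {f. h f \<in> alg_span K (h ` set gs)}"
        using assms(4) alg_span_superset[where K = K and S = "h ` set gs"]
        by (intro adjoin_list_least) auto
      then show ?thesis by auto
    qed
    moreover have "transcendental_over (alg_span K (h ` set gs)) (h g)"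
      using Cons.prems by (simp add: transcendental_over_alg_span_iff)
    ultimately have tr: "transcendental_over (h ` ?R) (h g)"
      using transcendental_over_subset by blast
    show ?case
      unfolding eq
      using R.inj_on_adjoin_elem[OF assms(1) _ tr] R.image_adjoin_elem[OF assms(1), of g]
        B.factorial_adjoin_elem[OF tr] Cons by simp
  qed
  then show "inj_on h (adjoin_list A gs)" "factorial_set (h ` adjoin_list A gs)" by auto
qed

text \<open>As the \<open>b i\<close> are algebraic, every product \<open>\<xi> * b i\<close> lies
  in a span containing \<open>\<xi>\<close>; so \<open>T\<close> spans all \<open>2n\<close> numbers
  in the conjecture. The products stay \<rat>-independent because \<open>\<xi>\<close> is
  non-zero.\<close>

lemma schanuel_alg_span_rank:
  assumes "schanuel_conjecture" "rat_linearly_independent n b" "\<xi> \<noteq> 0"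
    and "\<And>i. i \<in> {1..n} \<Longrightarrow> b i \<in> algebraic_numbers"
    and T: "finite T" "\<xi> \<in> alg_span algebraic_numbers T"
      "\<And>i. i \<in> {1..n} \<Longrightarrow> exp (b i * \<xi>) \<in> alg_span algebraic_numbers T"
  shows "n \<le> card T"
proof -
  let ?K = "algebraic_numbers" and ?x = "\<lambda>i. \<xi> * b i"
  interpret K: field_set ?K by (rule field_set_algebraic_numbers)
  interpret L: field_set "alg_span ?K T" by (rule field_set_alg_span)
  have b: "inj_on b {1..n}"
    "\<not> Modules.module.dependent (\<lambda>(q::rat) (z::complex). of_rat q * z) (b ` {1..n})"
    using assms(2) unfolding rat_linearly_independent_def by blast+
  have image: "(*) \<xi> ` b ` {1..n} = ?x ` {1..n}" by (rule image_image)
  have "inj_on ?x {1..n}"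
    using assms(3) by (intro inj_onI inj_onD[OF b(1)]) auto
  moreover have "\<not> Modules.module.dependent (\<lambda>(q::rat) (z::complex). of_rat q * z) (?x ` {1..n})"
    using rat_independent_scale[OF _ assms(3) b(2)] unfolding image by simp
  ultimately have "rat_linearly_independent n ?x"
    unfolding rat_linearly_independent_def by blast
  then have "enat n \<le> transcendence_degree ?K (field_adjoin ?K (?x ` {1..n} \<union> (\<lambda>i. exp (?x i)) ` {1..n}))"
    using assms(1) unfolding schanuel_conjecture_def by blast
  also have "\<dots> \<le> enat (card T)"
  proof (intro transcendence_degree_le_card K.ring_set_axioms T(1) field_adjoin_subset_alg_span)
    have "?x i \<in> alg_span ?K T" if "i \<in> {1..n}" for i
      using T(2) assms(4)[OF that] alg_span_superset(1)[where K = ?K and S = T]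
      by (auto intro: L.mult_mem)
    then show "?x ` {1..n} \<union> (\<lambda>i. exp (?x i)) ` {1..n} \<subseteq> alg_span ?K T"
      using T(3) by (auto simp: mult.commute)
  qed
  finally show ?thesis by simp
qed

lemma exists_free_generators:
  assumes "schanuel_conjecture" "rat_linearly_independent n b" "\<xi> \<noteq> 0"
    and "\<And>i. i \<in> {1..n} \<Longrightarrow> b i \<in> algebraic_numbers"
    and t: "t 0 = \<xi>" "\<And>i. i \<in> {1..n} \<Longrightarrow> t i = exp (b i * \<xi>)"
  shows "\<exists>j js. {0..n} = insert j (set js) \<and> alg_free algebraic_numbers (map t js)"
proof -
  let ?K = "algebraic_numbers"
  obtain js where js: "distinct js" "set js \<subseteq> {0..n}" "alg_free ?K (map t js)"
    "t ` {0..n} \<subseteq> alg_span ?K (t ` set js)"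
    using alg_free_basis[of "[0..<Suc n]" ?K t] by (auto simp: atLeastLessThanSuc_atLeastAtMost simp del: upt_Suc)
  have span: "t i \<in> alg_span ?K (t ` set js)" if "i \<le> n" for i
    using js(4) that by auto
  have "n \<le> card (t ` set js)"
  proof (rule schanuel_alg_span_rank[OF assms(1-4)])
    show "\<xi> \<in> alg_span ?K (t ` set js)" using span[of 0] t by simp
    show "exp (b i * \<xi>) \<in> alg_span ?K (t ` set js)" if "i \<in> {1..n}" for i
      using span[of i] t(2)[OF that] that by simp
  qed simp_all
  also have "\<dots> \<le> card (set js)" by (simp add: card_image_le)
  finally have n: "n \<le> card (set js)" .
  show ?thesis
  proof (cases "set js = {0..n}")
    \<comment> \<open>All \<open>n + 1\<close> values are independent, and any one of them may be
      set aside; the head of the list is taken.\<close>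
    case True
    then obtain j js' where "js = j # js'" by (cases js) auto
    then show ?thesis using js True by (intro exI[of _ j] exI[of _ js']) auto
  next
    case False
    \<comment> \<open>The basis uses at least \<open>n\<close> of the \<open>n + 1\<close> indices
      but not all, so exactly one is missing.\<close>
    have "card ({0..n} - set js) \<le> 1"
      using n js(2) by (simp add: card_Diff_subset)
    moreover obtain j where "j \<in> {0..n} - set js" using False js(2) by blast
    ultimately have "{0..n} - set js = {j}"
      by (metis card_le_Suc0_iff_eq finite_Diff finite_atLeastAtMost is_singletonI' is_singleton_the_elem
          One_nat_def empty_iff singletonD)
    then show ?thesis using js by (intro exI[of _ j] exI[of _ js]) auto
  qed
qed

section \<open>Generators, and the shift to natural exponents\<close>

lemma exponential_polynomial_const: "c \<in> algebraic_numbers \<Longrightarrow> exponential_polynomial (\<lambda>_. c)"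
  using field_set.axioms(1)[OF field_set_algebraic_numbers] exponential_polynomial_basic[of "[:c:]" 0]
  by (simp add: ring_set.const_poly_mem ring_set.zero_mem)

lemma exponential_polynomial_ident: "exponential_polynomial (\<lambda>x. x)"
proof -
  interpret K: field_set algebraic_numbers by (rule field_set_algebraic_numbers)
  have "[:0, 1:] \<in> polys_over algebraic_numbers"
    by (intro K.pCons_mem K.const_poly_mem K.zero_mem K.one_mem)
  then show ?thesis using exponential_polynomial_basic[of "[:0, 1:]" 0] by (simp add: K.zero_mem)
qed

lemma exponential_polynomial_exp: "\<beta> \<in> algebraic_numbers \<Longrightarrow> exponential_polynomial (\<lambda>x. exp (\<beta> * x))"
  using field_set.axioms(1)[OF field_set_algebraic_numbers] exponential_polynomial_basic[of "[:1:]" \<beta>]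
  by (simp add: ring_set.const_poly_mem ring_set.one_mem)

text \<open>\<open>c\<close> adds up the absolute values of all integer coordinates, so adding it to
  each coordinate leaves none negative, for all of \<open>E\<close> at once.\<close>

lemma exists_nat_exponents:
  assumes "finite E" "\<And>\<beta>. \<beta> \<in> E \<Longrightarrow> \<exists>z::nat \<Rightarrow> int. \<beta> = (\<Sum>i=1..n. of_int (z i) * b i)"
  shows "\<exists>c::nat. \<forall>\<beta>\<in>E. \<exists>k::nat \<Rightarrow> nat. \<beta> + of_nat c * (\<Sum>i=1..n. b i) = (\<Sum>i=1..n. of_nat (k i) * (b i :: complex))"
proof -
  obtain z where z: "\<And>\<beta>. \<beta> \<in> E \<Longrightarrow> \<beta> = (\<Sum>i=1..n. of_int (z \<beta> i) * b i)" using assms(2) by metis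
  define c where "c = (\<Sum>\<beta>\<in>E. \<Sum>i=1..n. nat \<bar>z \<beta> i\<bar>)"
  have le: "- z \<beta> i \<le> int c" if "\<beta> \<in> E" "i \<in> {1..n}" for \<beta> i
  proof -
    have "nat \<bar>z \<beta> i\<bar> \<le> (\<Sum>i=1..n. nat \<bar>z \<beta> i\<bar>)" using that by (intro member_le_sum) auto
    also have "\<dots> \<le> c" unfolding c_def using that assms(1)
      by (intro member_le_sum[of \<beta> E "\<lambda>\<beta>. \<Sum>i=1..n. nat \<bar>z \<beta> i\<bar>"]) auto
    finally show ?thesis by linarith
  qed
  have "\<beta> + of_nat c * (\<Sum>i=1..n. b i) = (\<Sum>i=1..n. of_nat (nat (z \<beta> i + int c)) * b i)" if "\<beta> \<in> E" for \<beta>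
  proof -
    have "(\<Sum>i=1..n. of_nat (nat (z \<beta> i + int c)) * b i) = (\<Sum>i=1..n. of_int (z \<beta> i) * b i + of_nat c * b i)"
    proof (intro sum.cong refl)
      fix i assume "i \<in> {1..n}"
      then have "z \<beta> i + int c \<ge> 0" using le[OF that, of i] by simp
      then have "(of_nat (nat (z \<beta> i + int c)) :: complex) = of_int (z \<beta> i) + of_nat c"
        by (simp add: of_nat_nat)
      then show "of_nat (nat (z \<beta> i + int c)) * b i = of_int (z \<beta> i) * b i + of_nat c * b i"
        by (simp add: distrib_right)
    qed
    then show ?thesis using z[OF that] by (simp add: sum.distrib sum_distrib_left)
  qed
  then show ?thesis by (intro exI[of _ c] ballI) (rule exI)
qed

text \<open>After the shift by \<open>\<gamma>\<close> each exponential is a monomial in the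
  generators. \<open>G\<close> is kept abstract because the order in which generators are adjoined
  depends on the value set aside.\<close>

lemma exponential_polynomial_shift_mem:
  fixes P :: "nat \<Rightarrow> complex poly" and b :: "nat \<Rightarrow> complex" and n N :: nat
  assumes "ring_set G" "\<And>c. c \<in> algebraic_numbers \<Longrightarrow> (\<lambda>_. c) \<in> G" "(\<lambda>x. x) \<in> G"
    and "\<And>i. i \<in> {1..n} \<Longrightarrow> (\<lambda>x. exp (b i * x)) \<in> G"
    and P: "\<And>l. l \<in> {1..N} \<Longrightarrow> P l \<in> polys_over algebraic_numbers"
    and k: "\<And>l. l \<in> {1..N} \<Longrightarrow> \<beta> l + \<gamma> = (\<Sum>i=1..n. of_nat (k l i) * b i)"
  shows "(\<lambda>x. (\<Sum>l=1..N. poly (P l) x * exp (\<beta> l * x)) * exp (\<gamma> * x)) \<in> G"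
proof -
  interpret G: ring_set G by fact
  define F where "F = (\<Sum>l=1..N. (\<Sum>d\<le>degree (P l). (\<lambda>_. coeff (P l) d) * (\<lambda>x. x) ^ d) *
      (\<Prod>i=1..n. (\<lambda>x. exp (b i * x)) ^ k l i))"
  have "F \<in> G"
    unfolding F_def using assms polys_overD[OF P]
    by (intro G.sum_mem G.mult_mem G.prod_mem G.power_mem) auto
  moreover have "F = (\<lambda>x. (\<Sum>l=1..N. poly (P l) x * exp (\<beta> l * x)) * exp (\<gamma> * x))"
  proof (rule ext)
    fix x
    have "exp (\<beta> l * x) * exp (\<gamma> * x) = (\<Prod>i=1..n. exp (b i * x) ^ k l i)" if "l \<in> {1..N}" for l
    proof -
      have "exp (\<beta> l * x) * exp (\<gamma> * x) = exp ((\<beta> l + \<gamma>) * x)"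
        by (simp add: exp_add distrib_right)
      also have "\<dots> = exp (\<Sum>i=1..n. of_nat (k l i) * (b i * x))"
        unfolding k[OF that] sum_distrib_right by (simp add: mult.assoc)
      also have "\<dots> = (\<Prod>i=1..n. exp (b i * x) ^ k l i)"
        by (subst Transcendental.exp_sum) (simp_all add: exp_of_nat_mult)
      finally show ?thesis .
    qed
    then show "F x = (\<Sum>l=1..N. poly (P l) x * exp (\<beta> l * x)) * exp (\<gamma> * x)"
      by (simp add: F_def sum_fun_apply prod_fun_apply power_fun_apply sum_distrib_right
          poly_altdef mult.assoc)
  qed
  ultimately show ?thesis by simp
qed

theorem theorem6:
  fixes f\<^sub>1 f\<^sub>2 :: "complex \<Rightarrow> complex" and \<xi> :: complex
  assumes "schanuel_conjecture"
    and "exponential_polynomial f\<^sub>1" and "f\<^sub>1 \<noteq> (\<lambda>x. 0)"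
    and "exponential_polynomial f\<^sub>2" and "f\<^sub>2 \<noteq> (\<lambda>x. 0)"
    and "\<xi> \<noteq> 0" and "f\<^sub>1 \<xi> = 0" and "f\<^sub>2 \<xi> = 0"
  shows "\<exists>f :: complex \<Rightarrow> complex.
           exponential_polynomial f \<and> f \<noteq> (\<lambda>x. 0) \<and> f \<xi> = 0 \<and>
           quotient_exponential_polynomial f\<^sub>1 f \<and> quotient_exponential_polynomial f\<^sub>2 f"
proof -
  let ?K = "algebraic_numbers"
  interpret K: field_set ?K by (rule field_set_algebraic_numbers)
  interpret E: ring_set "{f. exponential_polynomial f}" by (rule ring_set_exponential_polynomials)
  obtain N :: nat and P \<beta> where f1: "\<And>l. l \<in> {1..N} \<Longrightarrow> P l \<in> polys_over ?K"
    "\<And>l. l \<in> {1..N} \<Longrightarrow> \<beta> l \<in> ?K" "f\<^sub>1 = (\<lambda>x. \<Sum>l=1..N. poly (P l) x * exp (\<beta> l * x))"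
    using assms(2) by (rule exponential_polynomialE) blast
  obtain M :: nat and Q \<delta> where f2: "\<And>l. l \<in> {1..M} \<Longrightarrow> Q l \<in> polys_over ?K"
    "\<And>l. l \<in> {1..M} \<Longrightarrow> \<delta> l \<in> ?K" "f\<^sub>2 = (\<lambda>x. \<Sum>l=1..M. poly (Q l) x * exp (\<delta> l * x))"
    using assms(4) by (rule exponential_polynomialE) blast
  \<comment> \<open>Both sets of exponents are joined so that one basis and one shift serve both
    functions.\<close>
  let ?E = "\<beta> ` {1..N} \<union> \<delta> ` {1..M}"
  have "?E \<subseteq> ?K" using f1 f2 by auto
  then obtain n b where b: "rat_linearly_independent n b" "\<And>i. i \<in> {1..n} \<Longrightarrow> b i \<in> ?K"
    "\<And>e. e \<in> ?E \<Longrightarrow> \<exists>z::nat \<Rightarrow> int. e = (\<Sum>i=1..n. of_int (z i) * b i)"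
    using exists_integral_basis[OF _ field_set_algebraic_numbers, of ?E] by auto
  obtain c :: nat where c: "\<forall>e\<in>?E. \<exists>k::nat \<Rightarrow> nat.
      e + of_nat c * (\<Sum>i=1..n. b i) = (\<Sum>i=1..n. of_nat (k i) * b i)"
    using exists_nat_exponents[where E = ?E and n = n and b = b] b(3) by auto
  define \<gamma> where "\<gamma> = of_nat c * (\<Sum>i=1..n. b i)"
  from c obtain k where k: "\<And>e. e \<in> ?E \<Longrightarrow> e + \<gamma> = (\<Sum>i=1..n. of_nat (k e i) * b i)"
    unfolding \<gamma>_def by metis
  have "\<gamma> \<in> ?K"
  proof -
    have "of_nat m \<in> ?K" for m by (induction m) (auto intro: K.zero_mem K.add_mem K.one_mem)
    then show ?thesis unfolding \<gamma>_def using b(2) by (intro K.mult_mem K.sum_mem)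
  qed
  define g :: "nat \<Rightarrow> complex \<Rightarrow> complex" where "g i = (if i = 0 then (\<lambda>x. x) else (\<lambda>x. exp (b i * x)))" for i
  obtain j js where j: "{0..n} = insert j (set js)" "alg_free ?K (map (\<lambda>i. g i \<xi>) js)"
    using exists_free_generators[OF assms(1) b(1) assms(6) b(2), of "\<lambda>i. g i \<xi>"]
    by (auto simp: g_def)
  define A where "A = (\<lambda>c (_::complex). c) ` ?K"
  define h where "h f = f \<xi>" for f :: "complex \<Rightarrow> complex"
  have h: "unital_hom h" unfolding h_def by (rule unital_hom_apply)
  have A: "ring_set A"
  proof -
    have "unital_hom (\<lambda>c (_::complex). c :: complex)"
      by unfold_locales (auto simp: fun_eq_iff)
    then show ?thesis
      unfolding A_def using K.ring_set_axioms by (rule unital_hom.ring_set_image)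
  qed
  define R where "R = adjoin_list A (map g js)"
  interpret R: ring_set R unfolding R_def by (rule ring_set_adjoin_list(1)[OF A])
  have "inj_on h A" "h ` A = ?K" by (auto simp: A_def h_def inj_on_def image_image)
  moreover have "alg_free ?K (map h (map g js))" using j(2) by (simp add: h_def comp_def)
  ultimately have R: "inj_on h R" "factorial_set (h ` R)"
    unfolding R_def using adjoin_list_alg_free[OF h A _ _ field_set_algebraic_numbers] by auto
  \<comment> \<open>Evaluation at \<open>\<xi>\<close> is injective on \<open>R\<close> but not on
    \<open>G\<close>, which will contain the non-zero function \<open>F1\<close> vanishing
    there.\<close>
  define G where "G = adjoin_elem R (g j)"
  interpret G: ring_set G unfolding G_def by (rule R.ring_set_adjoin_elem)
  have gE: "exponential_polynomial (g i)" if "i \<in> {0..n}" for i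
    using that b(2) exponential_polynomial_ident exponential_polynomial_exp by (auto simp: g_def)
  have "R \<subseteq> {f. exponential_polynomial f}"
    unfolding R_def
    using j(1) gE exponential_polynomial_const
    by (intro adjoin_list_least ring_set_exponential_polynomials) (auto simp: A_def)
  then have GE: "G \<subseteq> {f. exponential_polynomial f}"
    unfolding G_def using j(1) gE by (intro E.adjoin_elem_least) auto
  have RG: "R \<subseteq> G" unfolding G_def by (rule R.subset_adjoin_elem)
  then have constG: "(\<lambda>_. c) \<in> G" if "c \<in> ?K" for c
    using ring_set_adjoin_list(2)[OF A, of "map g js"] that by (auto simp: R_def A_def)
  have gG: "g i \<in> G" if "i \<in> {0..n}" for i
    using that j(1) RG ring_set_adjoin_list(3)[OF A, of "map g js"] R.mem_adjoin_elem[of "g j"]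
    unfolding R_def G_def by auto
  have expG: "(\<lambda>x. exp (b i * x)) \<in> G" if "i \<in> {1..n}" for i
    using gG[of i] that by (simp add: g_def)
  have identG: "(\<lambda>x. x) \<in> G" using gG[of 0] by (simp add: g_def)
  \<comment> \<open>The factor \<open>exp (\<gamma> * x)\<close> has no zeros, so the shift
    preserves both the zero at \<open>\<xi>\<close> and being non-zero.\<close>
  define F1 where "F1 = (\<lambda>x. f\<^sub>1 x * exp (\<gamma> * x))"
  define F2 where "F2 = (\<lambda>x. f\<^sub>2 x * exp (\<gamma> * x))"
  have F: "F1 \<in> G" "F2 \<in> G"
  proof -
    note shift = exponential_polynomial_shift_mem[OF G.ring_set_axioms constG identG expG]
    have "\<beta> l + \<gamma> = (\<Sum>i=1..n. of_nat (k (\<beta> l) i) * b i)" if "l \<in> {1..N}" for l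
      using k that by blast
    then show "F1 \<in> G" unfolding F1_def f1(3) by (intro shift f1(1))
    have "\<delta> l + \<gamma> = (\<Sum>i=1..n. of_nat (k (\<delta> l) i) * b i)" if "l \<in> {1..M}" for l
      using k that by blast
    then show "F2 \<in> G" unfolding F2_def f2(3) by (intro shift f2(1))
  qed
  have "F1 \<noteq> 0" using assms(3) by (auto simp: F1_def fun_eq_iff)
  moreover have "h F1 = 0" "h F2 = 0" using assms by (auto simp: h_def F1_def F2_def)
  ultimately obtain f where f: "f \<in> G" "h f = 0"
    "\<And>F. F \<in> G \<Longrightarrow> h F = 0 \<Longrightarrow> \<exists>q\<in>G. F = f * q"
    using R.kernel_on_adjoin_elem_principal[OF h R, of F1 "g j"] F(1) unfolding G_def by blast
  \<comment> \<open>Multiplying the cofactor found in \<open>G\<close> by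
    \<open>exp (- \<gamma> * x)\<close> undoes the shift; the result is an exponential polynomial
    because \<open>\<gamma>\<close> is algebraic.\<close>
  have quotient: "quotient_exponential_polynomial f' f"
    if F': "F' \<in> G" "h F' = 0" and eq: "F' = (\<lambda>x. f' x * exp (\<gamma> * x))" for F' f'
  proof -
    obtain q where q: "q \<in> G" "F' = f * q" using f(3)[OF F'] by blast
    have "exponential_polynomial (q * (\<lambda>x. exp (- \<gamma> * x)))"
      using E.mult_mem[of q "\<lambda>x. exp (- \<gamma> * x)"] q(1) GE
        exponential_polynomial_exp[OF K.uminus_mem[OF \<open>\<gamma> \<in> ?K\<close>]] by auto
    moreover have "f' x = f x * (q * (\<lambda>x. exp (- \<gamma> * x))) x" for x
    proof -
      have "f' x * exp (\<gamma> * x) = f x * q x"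
        using fun_cong[OF q(2), of x] by (simp add: eq)
      then have "f' x * (exp (\<gamma> * x) * exp (- \<gamma> * x)) = f x * (q x * exp (- \<gamma> * x))"
        by (simp only: mult.assoc[symmetric])
      then show ?thesis by (simp add: exp_minus)
    qed
    ultimately show ?thesis unfolding quotient_exponential_polynomial_def by blast
  qed
  have q1: "quotient_exponential_polynomial f\<^sub>1 f" and q2: "quotient_exponential_polynomial f\<^sub>2 f"
    using quotient[of F1 f\<^sub>1] quotient[of F2 f\<^sub>2] F \<open>h F1 = 0\<close> \<open>h F2 = 0\<close> by (auto simp: F1_def F2_def)
  \<comment> \<open>If \<open>f\<close> were zero, so would be its multiple
    \<open>f\<^sub>1\<close>.\<close>
  have "f \<noteq> (\<lambda>x. 0)"
    using q1 assms(3) by (auto simp: quotient_exponential_polynomial_def fun_eq_iff)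
  then show ?thesis
    using f(1,2) GE q1 q2 by (intro exI[of _ f]) (auto simp: h_def)
qed

end
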